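(* The element $$\mathrm{GV}:=\mathbf 1\otimes\log\sigma\otimes\sigma^{-2}\sigma^1_{1,1}-\mathbf 1\otimes\sigma^{-2}\sigma^1_{1,1}\otimes\sigma^{-1}\log\sigma\in{}^{\sigma^{-1}}\mathbb C\otimes\tilde{\mathcal K}_1\otimes\tilde{\mathcal K}_1$$ is a cyclic cocycle (in the Hopf cyclic complex of $\tilde{\mathcal K}_1$ with coefficients in ${}^{\sigma^{-1}}\mathbb C$).
   Context: $\mathbf G$ is the discrete group of orientation preserving diffeomorphisms of $\mathbb R$; $\mathcal A=C_c^\infty(\mathbb R)\rtimes\mathbf G$ consists of finite sums $\sum f_iU^*_{\varphi_i}$ with $fU^*_\varphi\,gU^*_\psi=f(g\circ\varphi)U^*_{\psi\varphi}$. $\mathcal K_1$ is the unital algebra of operators on $\mathcal A$ generated by $X_1(fU^*_\varphi)=f'U^*_\varphi$ and $\sigma^{\pm1}(fU^*_\varphi)=(\varphi')^{\pm1}fU^*_\varphi$; $\sigma_k(fU^*_\varphi)=\varphi^{(k)}fU^*_\varphi$, $\sigma_1=\sigma$, $\sigma^1_{1,1}=\sigma_2=[X_1,\sigma]$. It is a Hopf algebra with coproduct determined by $k(ab)=k_{(1)}(a)k_{(2)}(b)$, counit by $k(1)=\varepsilon(k)1$, antipode $S$; e.g. $\Delta(\sigma)=\sigma\otimes\sigma$, $\Delta(\sigma^1_{1,1})=\sigma^1_{1,1}\otimes\sigma+\sigma^2\otimes\sigma^1_{1,1}$. $\tilde{\mathcal K}_1$ is the Hopf algebra obtained by adjoining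 to $\mathcal K_1$ a primitive element $\log\sigma$, with $[X_1,\log\sigma]=\sigma^{-1}\sigma^1_{1,1}$, $[\log\sigma,\sigma_k]=0$ for all $k$, $\Delta(\log\sigma)=\log\sigma\otimes1+1\otimes\log\sigma$, $\varepsilon(\log\sigma)=0$, $S(\log\sigma)=-\log\sigma$. The Hopf cyclic complex is that of the cocyclic module $\tilde{\mathcal K}_1^{\otimes q}$ (elements written $\mathbf 1\otimes k^1\otimes\cdots\otimes k^q$) with $d_0$ inserting $1$ on the left, $d_i=\Delta$ on the $i$-th factor, $d_{q+1}$ inserting $\sigma^{-1}$ on the right, codegeneracies given by $\varepsilon$, $\tau_q(k^1\otimes\cdots\otimes k^q)=\Delta^{(q-1)}(S(k^1))\cdot(k^2\otimes\cdots\otimes k^q\otimes\sigma^{-1})$. A cyclic cocycle of degree $q$ is an element $c$ with $bc=\sum_{i=0}^{q+1}(-1)^id_i(c)=0$ and $\tau_q(c)=(-1)^qc$. *)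

theory Defs
  imports "HOL-Analysis.Analysis" "HOL-Library.Poly_Mapping"
begin

section \<open>Complex vector spaces and complex algebras\<close>

class complex_vector = ab_group_add +
  fixes scaleC :: "complex \<Rightarrow> 'a \<Rightarrow> 'a" (infixr \<open>*\<^sub>C\<close> 75)
  assumes scaleC_add_right: "c *\<^sub>C (x + y) = c *\<^sub>C x + c *\<^sub>C y"
    and scaleC_add_left: "(c + d) *\<^sub>C x = c *\<^sub>C x + d *\<^sub>C x"
    and scaleC_scaleC: "c *\<^sub>C d *\<^sub>C x = (c * d) *\<^sub>C x"
    and scaleC_one: "1 *\<^sub>C x = x"

text \<open>The class \<^class>\<open>ring_1\<close> is not used here because it includes \<open>0 \<noteq> 1\<close>.\<close>

class complex_algebra_1 = complex_vector + ring + monoid_mult +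
  assumes mult_scaleC_left: "(c *\<^sub>C x) * y = c *\<^sub>C (x * y)"
    and mult_scaleC_right: "x * (c *\<^sub>C y) = c *\<^sub>C (x * y)"

interpretation cv: vector_space "scaleC :: complex \<Rightarrow> 'a \<Rightarrow> 'a::complex_vector"
  by unfold_locales
    (simp_all add: scaleC_add_right scaleC_add_left scaleC_scaleC scaleC_one)

abbreviation clinear :: "('a::complex_vector \<Rightarrow> 'b::complex_vector) \<Rightarrow> bool"
  where "clinear \<equiv> Vector_Spaces.linear scaleC scaleC"

instantiation complex :: complex_algebra_1
begin

definition "c *\<^sub>C (z::complex) = c * z"

instance
  by standard (simp_all add: scaleC_complex_def algebra_simps)

end

instantiation poly_mapping :: (type, complex_vector) complex_vector
begin

lift_definition scaleC_poly_mapping ::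
    "complex \<Rightarrow> ('a \<Rightarrow>\<^sub>0 'b) \<Rightarrow> 'a \<Rightarrow>\<^sub>0 'b" is "\<lambda>c p k. c *\<^sub>C p k"
  by (erule rev_finite_subset) auto

instance
  by (standard; transfer)
    (simp_all add: scaleC_add_right scaleC_add_left scaleC_scaleC scaleC_one)

end


section \<open>The tensor algebra of a complex vector space\<close>

text \<open>
  The full tensor algebra is the free vector space on all finite lists of vectors,
  modulo multilinearity in every slot; its homogeneous component of degree \<open>q\<close>
  (\<open>tpow q\<close> below) is the \<open>q\<close>-fold tensor power over the complex numbers.
\<close>

definition multilinear_relations :: "('h::complex_vector list \<Rightarrow>\<^sub>0 complex) set"
  where "multilinear_relations =
    {Poly_Mapping.single (xs @ (c *\<^sub>C x + y) # ys) 1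
       - (Poly_Mapping.single (xs @ x # ys) c + Poly_Mapping.single (xs @ y # ys) 1)
     | xs ys x y c. True}"

quotient_type (overloaded) 'h tensor = "'h::complex_vector list \<Rightarrow>\<^sub>0 complex" /
    "\<lambda>u v. u - v \<in> cv.span multilinear_relations"
  morphisms rep_tensor abs_tensor
proof (rule equivpI)
  show "reflp (\<lambda>u v :: 'h list \<Rightarrow>\<^sub>0 complex. u - v \<in> cv.span multilinear_relations)"
    by (simp add: reflp_def cv.span_zero)
  show "symp (\<lambda>u v :: 'h list \<Rightarrow>\<^sub>0 complex. u - v \<in> cv.span multilinear_relations)"
    by (metis (mono_tags, lifting) cv.span_neg minus_diff_eq sympI)
  show "transp (\<lambda>u v :: 'h list \<Rightarrow>\<^sub>0 complex. u - v \<in> cv.span multilinear_relations)"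
    by (rule transpI) (metis (no_types, lifting) cv.span_add diff_add_cancel add_diff_eq)
qed

instantiation tensor :: (complex_vector) complex_vector
begin

lift_definition zero_tensor :: "'a tensor" is 0 .

lift_definition plus_tensor :: "'a tensor \<Rightarrow> 'a tensor \<Rightarrow> 'a tensor" is "(+)"
  by (metis (no_types, lifting) cv.span_add add_diff_add)

lift_definition uminus_tensor :: "'a tensor \<Rightarrow> 'a tensor" is uminus
  by (metis (no_types, lifting) cv.span_neg minus_diff_minus)

lift_definition minus_tensor :: "'a tensor \<Rightarrow> 'a tensor \<Rightarrow> 'a tensor" is "(-)"
proof -
  fix u u' v v' :: "'a list \<Rightarrow>\<^sub>0 complex"
  assume "u - u' \<in> cv.span multilinear_relations" "v - v' \<in> cv.span multilinear_relations"
  then have "(u - u') - (v - v') \<in> cv.span multilinear_relations" by (rule cv.span_diff)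
  then show "(u - v) - (u' - v') \<in> cv.span multilinear_relations"
    by (simp add: algebra_simps)
qed

lift_definition scaleC_tensor :: "complex \<Rightarrow> 'a tensor \<Rightarrow> 'a tensor" is scaleC
  by (metis cv.scale_right_diff_distrib cv.span_scale)

instance
  by (standard; transfer)
    (simp_all add: scaleC_add_right scaleC_add_left scaleC_scaleC scaleC_one cv.span_zero
      algebra_simps)

end

lift_definition pure_tensor :: "'h::complex_vector list \<Rightarrow> 'h tensor"
  is "\<lambda>xs. Poly_Mapping.single xs 1" .

definition tpow :: "nat \<Rightarrow> 'h::complex_vector tensor set"
  where "tpow q = cv.span {pure_tensor xs | xs. length xs = q}"

text \<open>
  Linear extension from pure tensors. This is the map induced by \<open>f\<close> as soon as
  \<open>f\<close> is linear in every slot, on lists of every length (lemmas \<open>tlift_pure\<close> and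
  \<open>tlift_linear\<close>); maps defined on a single tensor power therefore have to be
  extended by \<open>0\<close> to the lists of all other lengths.
\<close>

definition tlift :: "('h::complex_vector list \<Rightarrow> 'b::complex_vector) \<Rightarrow> 'h tensor \<Rightarrow> 'b"
  where "tlift f t =
    (\<Sum>xs\<in>Poly_Mapping.keys (rep_tensor t). Poly_Mapping.lookup (rep_tensor t) xs *\<^sub>C f xs)"

definition multilinear :: "('h::complex_vector list \<Rightarrow> 'b::complex_vector) \<Rightarrow> bool"
  where "multilinear f \<longleftrightarrow>
    (\<forall>xs ys x y c. f (xs @ (c *\<^sub>C x + y) # ys) = c *\<^sub>C f (xs @ x # ys) + f (xs @ y # ys))"

definition flift :: "('h list \<Rightarrow> 'b::complex_vector) \<Rightarrow> ('h list \<Rightarrow>\<^sub>0 complex) \<Rightarrow> 'b"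
  where "flift f p = (\<Sum>xs\<in>Poly_Mapping.keys p. Poly_Mapping.lookup p xs *\<^sub>C f xs)"

lemma flift_superset:
  assumes "finite K" "Poly_Mapping.keys p \<subseteq> K"
  shows "flift f p = (\<Sum>xs\<in>K. Poly_Mapping.lookup p xs *\<^sub>C f xs)"
  unfolding flift_def using assms
  by (intro sum.mono_neutral_left) (auto simp: in_keys_iff)

lemma flift_add: "flift f (p + q) = flift f p + flift f q"
proof -
  let ?K = "Poly_Mapping.keys p \<union> Poly_Mapping.keys q"
  have "flift f (p + q) = (\<Sum>xs\<in>?K. Poly_Mapping.lookup (p + q) xs *\<^sub>C f xs)"
    by (rule flift_superset) (auto simp: in_keys_iff lookup_add)
  also have "\<dots> = flift f p + flift f q"
    by (simp add: flift_superset [of ?K p] flift_superset [of ?K q] lookup_add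
        scaleC_add_left sum.distrib)
  finally show ?thesis .
qed

lemma flift_scaleC: "flift f (c *\<^sub>C p) = c *\<^sub>C flift f p"
proof -
  have "flift f (c *\<^sub>C p) = (\<Sum>xs\<in>Poly_Mapping.keys p. Poly_Mapping.lookup (c *\<^sub>C p) xs *\<^sub>C f xs)"
    by (rule flift_superset)
      (auto simp: in_keys_iff scaleC_poly_mapping.rep_eq scaleC_complex_def)
  also have "\<dots> = c *\<^sub>C flift f p"
    by (simp add: flift_def scaleC_poly_mapping.rep_eq scaleC_complex_def
        cv.scale_sum_right scaleC_scaleC)
  finally show ?thesis .
qed

lemma flift_linear: "clinear (flift f)"
  by (simp add: Vector_Spaces.linear_iff flift_add flift_scaleC cv.vector_space_axioms)

lemma flift_single: "flift f (Poly_Mapping.single xs c) = c *\<^sub>C f xs"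
  by (cases "c = 0") (simp_all add: flift_def)

lemma flift_relations:
  assumes "multilinear f" "p \<in> cv.span multilinear_relations"
  shows "flift f p = 0"
proof -
  interpret L: Vector_Spaces.linear scaleC scaleC "flift f" by (rule flift_linear)
  have "flift f r = 0" if "r \<in> multilinear_relations" for r
    using that assms(1)
    by (auto simp: multilinear_relations_def multilinear_def L.diff L.add flift_single scaleC_one)
  then show ?thesis
    using assms(2) L.eq_0_on_span by blast
qed

lemma tlift_abs:
  assumes "multilinear f"
  shows "tlift f (abs_tensor p) = flift f p"
proof -
  interpret L: Vector_Spaces.linear scaleC scaleC "flift f" by (rule flift_linear)
  have "rep_tensor (abs_tensor p) - p \<in> cv.span multilinear_relations"
    using Quotient3_rep_abs [OF Quotient3_tensor] by (simp add: cv.span_zero)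
  then have "flift f (rep_tensor (abs_tensor p) - p) = 0"
    by (rule flift_relations [OF assms])
  then have "flift f (rep_tensor (abs_tensor p)) = flift f p" by (simp add: L.diff)
  then show ?thesis by (simp add: tlift_def flift_def)
qed

lemma tlift_pure: "multilinear f \<Longrightarrow> tlift f (pure_tensor xs) = f xs"
  by (simp add: pure_tensor.abs_eq tlift_abs flift_single scaleC_one)

lemma tlift_linear:
  assumes "multilinear f"
  shows "clinear (tlift f)"
proof -
  have "tlift f (s + t) = tlift f s + tlift f t" for s t
    by (induct s rule: tensor.abs_induct, induct t rule: tensor.abs_induct)
      (simp add: plus_tensor.abs_eq tlift_abs [OF assms] flift_add)
  moreover have "tlift f (c *\<^sub>C s) = c *\<^sub>C tlift f s" for c s
    by (induct s rule: tensor.abs_induct)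
      (simp add: scaleC_tensor.abs_eq tlift_abs [OF assms] flift_scaleC)
  ultimately show ?thesis
    by (simp add: Vector_Spaces.linear_iff cv.vector_space_axioms)
qed

text \<open>Multiplication of the tensor algebra (juxtaposition of tensors).\<close>

definition tcat :: "'h::complex_vector tensor \<Rightarrow> 'h tensor \<Rightarrow> 'h tensor" (infixr \<open>\<otimes>\<close> 70)
  where "s \<otimes> t = tlift (\<lambda>xs. tlift (\<lambda>ys. pure_tensor (xs @ ys)) t) s"

text \<open>Factorwise product, that is, the algebra structure of each tensor power.\<close>

definition tmul :: "'h::complex_algebra_1 tensor \<Rightarrow> 'h tensor \<Rightarrow> 'h tensor" (infixl \<open>\<odot>\<close> 70)
  where "s \<odot> t = tlift (\<lambda>xs. tlift (\<lambda>ys.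
      if length xs = length ys then pure_tensor (map2 (*) xs ys) else 0) t) s"

text \<open>\<open>at_factor i F\<close> is \<open>id \<otimes> \<dots> \<otimes> F \<otimes> \<dots> \<otimes> id\<close> with \<open>F\<close> in position \<open>i\<close>, counted from 0.\<close>

definition at_factor ::
    "nat \<Rightarrow> ('h::complex_vector \<Rightarrow> 'h tensor) \<Rightarrow> 'h tensor \<Rightarrow> 'h tensor"
  where "at_factor i F = tlift (\<lambda>xs.
      if i < length xs
      then pure_tensor (take i xs) \<otimes> F (xs ! i) \<otimes> pure_tensor (drop (Suc i) xs) else 0)"


section \<open>Hopf algebras and their cyclic complex\<close>

definition hopf_algebra ::
    "('h::complex_algebra_1 \<Rightarrow> 'h tensor) \<Rightarrow> ('h \<Rightarrow> complex) \<Rightarrow> ('h \<Rightarrow> 'h) \<Rightarrow> bool"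
  where "hopf_algebra \<Delta> \<epsilon> S \<longleftrightarrow>
    clinear \<Delta> \<and> clinear \<epsilon> \<and> clinear S \<and>
    (\<forall>h. \<Delta> h \<in> tpow 2) \<and>
    \<Delta> 1 = pure_tensor [1, 1] \<and> (\<forall>g h. \<Delta> (g * h) = \<Delta> g \<odot> \<Delta> h) \<and>
    \<epsilon> 1 = 1 \<and> (\<forall>g h. \<epsilon> (g * h) = \<epsilon> g * \<epsilon> h) \<and>
    (\<forall>h. at_factor 0 \<Delta> (\<Delta> h) = at_factor 1 \<Delta> (\<Delta> h)) \<and>
    (\<forall>h. at_factor 0 (\<lambda>k. \<epsilon> k *\<^sub>C pure_tensor []) (\<Delta> h) = pure_tensor [h]) \<and>
    (\<forall>h. at_factor 1 (\<lambda>k. \<epsilon> k *\<^sub>C pure_tensor []) (\<Delta> h) = pure_tensor [h]) \<and>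
    (\<forall>h. tlift (\<lambda>xs. case xs of [x, y] \<Rightarrow> S x * y | _ \<Rightarrow> 0) (\<Delta> h) = \<epsilon> h *\<^sub>C 1) \<and>
    (\<forall>h. tlift (\<lambda>xs. case xs of [x, y] \<Rightarrow> x * S y | _ \<Rightarrow> 0) (\<Delta> h) = \<epsilon> h *\<^sub>C 1)"

text \<open>
  The iterated coproduct, with \<open>iterated_coproduct \<Delta> n h\<close> in degree \<open>n + 1\<close>.
\<close>

primrec iterated_coproduct ::
    "('h::complex_algebra_1 \<Rightarrow> 'h tensor) \<Rightarrow> nat \<Rightarrow> 'h \<Rightarrow> 'h tensor"
  where
    "iterated_coproduct \<Delta> 0 h = pure_tensor [h]"
  | "iterated_coproduct \<Delta> (Suc n) h = at_factor 0 \<Delta> (iterated_coproduct \<Delta> n h)"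

text \<open>
  The cyclic complex with coefficients in the one-dimensional module and comodule
  given by the counit and a group-like element \<open>g\<close>: the coefficient factor
  \<open>\<one> \<otimes> _\<close> is the identification of \<open>\<complex> \<otimes> H\<^sup>\<otimes>\<^sup>q\<close> with \<open>H\<^sup>\<otimes>\<^sup>q\<close>.
\<close>

definition coface ::
    "('h::complex_algebra_1 \<Rightarrow> 'h tensor) \<Rightarrow> 'h \<Rightarrow> nat \<Rightarrow> nat \<Rightarrow> 'h tensor \<Rightarrow> 'h tensor"
  where "coface \<Delta> g q i c =
    (if i = 0 then pure_tensor [1] \<otimes> c
     else if i \<le> q then at_factor (i - 1) \<Delta> c
     else c \<otimes> pure_tensor [g])"

definition hochschild_coboundary ::
    "('h::complex_algebra_1 \<Rightarrow> 'h tensor) \<Rightarrow> 'h \<Rightarrow> nat \<Rightarrow> 'h tensor \<Rightarrow> 'h tensor"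
  where "hochschild_coboundary \<Delta> g q c = (\<Sum>i=0..q+1. (-1) ^ i *\<^sub>C coface \<Delta> g q i c)"

definition cyclic_operator ::
    "('h::complex_algebra_1 \<Rightarrow> 'h tensor) \<Rightarrow> ('h \<Rightarrow> 'h) \<Rightarrow> 'h \<Rightarrow> nat \<Rightarrow> 'h tensor \<Rightarrow> 'h tensor"
  where "cyclic_operator \<Delta> S g q = tlift (\<lambda>xs.
      if length xs = q
      then (case xs of
              [] \<Rightarrow> pure_tensor []
            | k # ks \<Rightarrow> iterated_coproduct \<Delta> (q - 1) (S k) \<odot> pure_tensor (ks @ [g]))
      else 0)"

definition cyclic_cocycle ::
    "('h::complex_algebra_1 \<Rightarrow> 'h tensor) \<Rightarrow> ('h \<Rightarrow> 'h) \<Rightarrow> 'h \<Rightarrow> nat \<Rightarrow> 'h tensor \<Rightarrow> bool"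
  where "cyclic_cocycle \<Delta> S g q c \<longleftrightarrow>
    c \<in> tpow q \<and> hochschild_coboundary \<Delta> g q c = 0 \<and>
    cyclic_operator \<Delta> S g q c = (-1) ^ q *\<^sub>C c"


section \<open>Smooth functions and diffeomorphisms of the line\<close>

definition vderiv :: "(real \<Rightarrow> 'a::real_normed_vector) \<Rightarrow> real \<Rightarrow> 'a"
  where "vderiv f x = vector_derivative f (at x)"

definition smooth :: "(real \<Rightarrow> 'a::real_normed_vector) \<Rightarrow> bool"
  where "smooth f \<longleftrightarrow> (\<forall>n x. (vderiv ^^ n) f differentiable at x)"

primrec times_differentiable :: "nat \<Rightarrow> (real \<Rightarrow> 'a::real_normed_vector) \<Rightarrow> bool"
  where
    "times_differentiable 0 f \<longleftrightarrow> True"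
  | "times_differentiable (Suc n) f \<longleftrightarrow>
      (\<forall>x. f differentiable at x) \<and> times_differentiable n (vderiv f)"

lemma smooth_differentiable: "smooth f \<Longrightarrow> f differentiable at x"
  unfolding smooth_def by (metis funpow_0)

lemma smooth_vderiv: "smooth f \<Longrightarrow> smooth (vderiv f)"
  unfolding smooth_def by (metis comp_apply funpow_Suc_right)

lemma smooth_vderivs: "smooth f \<Longrightarrow> smooth ((vderiv ^^ n) f)"
  by (induction n) (simp_all add: smooth_vderiv)

lemma smooth_iff: "smooth f \<longleftrightarrow> (\<forall>n. times_differentiable n f)"
proof
  assume "smooth f"
  then have "times_differentiable n f" for n
    by (induction n arbitrary: f) (simp_all add: smooth_differentiable smooth_vderiv)
  then show "\<forall>n. times_differentiable n f" ..
next
  assume *: "\<forall>n. times_differentiable n f"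
  have "times_differentiable (n + m) f \<Longrightarrow> times_differentiable m ((vderiv ^^ n) f)" for n m
    by (induction n arbitrary: f) (simp_all add: funpow_Suc_right del: funpow.simps)
  then have "times_differentiable (Suc 0) ((vderiv ^^ n) f)" for n
    using * by blast
  then show "smooth f" by (simp add: smooth_def)
qed

lemma has_vderiv: "f differentiable at x \<Longrightarrow> (f has_vector_derivative vderiv f x) (at x)"
  by (simp add: vderiv_def vector_derivative_works)

lemma vderivI:
  assumes "\<And>x. (f has_vector_derivative f' x) (at x)"
  shows "vderiv f = f'" "f differentiable at x"
  using assms by (auto simp: vderiv_def vector_derivative_at intro: differentiableI_vector)

lemma times_differentiable_SucD:
  "times_differentiable (Suc n) f \<Longrightarrow> times_differentiable n f"
  by (induction n arbitrary: f) auto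

lemma times_differentiable_SucI:
  assumes "\<And>x. (f has_vector_derivative f' x) (at x)" "times_differentiable n f'"
  shows "times_differentiable (Suc n) f"
  using assms vderivI [of f f'] by simp

lemma times_differentiable_const: "times_differentiable n (\<lambda>x. c)"
proof (induction n arbitrary: c)
  case (Suc n)
  then show ?case
    by (intro times_differentiable_SucI [of _ "\<lambda>x. 0"]) auto
qed simp

lemma times_differentiable_add:
  "times_differentiable n f \<Longrightarrow> times_differentiable n g \<Longrightarrow>
    times_differentiable n (\<lambda>x. f x + g x)"
proof (induction n arbitrary: f g)
  case (Suc n)
  then show ?case
    by (intro times_differentiable_SucI [of _ "\<lambda>x. vderiv f x + vderiv g x"])
      (auto intro!: derivative_intros has_vderiv)
qed simp

lemma (in bounded_bilinear) times_differentiable: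
  "times_differentiable n f \<Longrightarrow> times_differentiable n g \<Longrightarrow>
    times_differentiable n (\<lambda>x. prod (f x) (g x))"
proof (induction n arbitrary: f g)
  case (Suc n)
  note times_differentiable_SucD [OF Suc.prems(1)] times_differentiable_SucD [OF Suc.prems(2)]
  with Suc show ?case
    by (intro times_differentiable_SucI
        [of _ "\<lambda>x. prod (f x) (vderiv g x) + prod (vderiv f x) (g x)"])
      (auto intro!: has_vector_derivative has_vderiv times_differentiable_add)
qed simp

lemma times_differentiable_compose:
  fixes \<phi> :: "real \<Rightarrow> real"
  shows "times_differentiable n f \<Longrightarrow> times_differentiable n \<phi> \<Longrightarrow>
    times_differentiable n (\<lambda>x. f (\<phi> x))"
proof (induction n arbitrary: f)
  case (Suc n)
  have "((f \<circ> \<phi>) has_vector_derivative vderiv \<phi> x *\<^sub>R vderiv f (\<phi> x)) (at x)" for x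
    using Suc.prems by (intro vector_diff_chain_at has_vderiv) auto
  moreover have "times_differentiable n (\<lambda>x. vderiv f (\<phi> x))"
    using Suc.prems by (intro Suc.IH times_differentiable_SucD [of n \<phi>]) auto
  ultimately show ?case
    using Suc.prems
    by (intro times_differentiable_SucI [of _ "\<lambda>x. vderiv \<phi> x *\<^sub>R vderiv f (\<phi> x)"]
        bounded_bilinear.times_differentiable [OF bounded_bilinear_scaleR])
      (auto simp: o_def)
qed simp

lemma times_differentiable_inverse:
  fixes f :: "real \<Rightarrow> real"
  assumes "\<And>x. f x \<noteq> 0"
  shows "times_differentiable n f \<Longrightarrow> times_differentiable n (\<lambda>x. inverse (f x))"
proof (induction n)
  case (Suc n)
  have "((\<lambda>x. inverse (f x)) has_vector_derivative
      (-1) * (vderiv f x * (inverse (f x) * inverse (f x)))) (at x)" for x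
  proof -
    have "(f has_real_derivative vderiv f x) (at x)"
      using Suc.prems has_vderiv [of f x]
      by (simp add: has_real_derivative_iff_has_vector_derivative)
    from DERIV_inverse_fun [OF this assms] show ?thesis
      by (simp add: has_real_derivative_iff_has_vector_derivative [symmetric] mult_ac
          power2_eq_square)
  qed
  moreover have "times_differentiable n (\<lambda>x. inverse (f x))"
    by (rule Suc.IH [OF times_differentiable_SucD [OF Suc.prems]])
  ultimately show ?case
    using Suc.prems
    by (intro times_differentiable_SucI
        [of _ "\<lambda>x. (-1) * (vderiv f x * (inverse (f x) * inverse (f x)))"]
        bounded_bilinear.times_differentiable [OF bounded_bilinear_mult]
        times_differentiable_const) auto
qed simp

lemma smooth_const: "smooth (\<lambda>x. c)"
  by (simp add: smooth_iff times_differentiable_const)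

lemma smooth_add: "smooth f \<Longrightarrow> smooth g \<Longrightarrow> smooth (\<lambda>x. f x + g x)"
  by (simp add: smooth_iff times_differentiable_add)

lemma smooth_mult:
  fixes f g :: "real \<Rightarrow> 'a::real_normed_algebra"
  shows "smooth f \<Longrightarrow> smooth g \<Longrightarrow> smooth (\<lambda>x. f x * g x)"
  by (simp add: smooth_iff bounded_bilinear.times_differentiable [OF bounded_bilinear_mult])

lemma smooth_scaleR: "smooth s \<Longrightarrow> smooth f \<Longrightarrow> smooth (\<lambda>x. s x *\<^sub>R f x)"
  by (simp add: smooth_iff bounded_bilinear.times_differentiable [OF bounded_bilinear_scaleR])

lemma smooth_compose: "smooth f \<Longrightarrow> smooth \<phi> \<Longrightarrow> smooth (\<lambda>x. f (\<phi> x))"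
  for \<phi> :: "real \<Rightarrow> real"
  by (simp add: smooth_iff times_differentiable_compose)

lemma smooth_inverse:
  fixes f :: "real \<Rightarrow> real"
  shows "smooth f \<Longrightarrow> (\<And>x. f x \<noteq> 0) \<Longrightarrow> smooth (\<lambda>x. inverse (f x))"
  by (simp add: smooth_iff times_differentiable_inverse)

lemma smooth_id: "smooth (\<lambda>x. x)"
  unfolding smooth_iff
proof
  fix n show "times_differentiable n (\<lambda>x::real. x)"
    by (cases n)
      (auto intro!: times_differentiable_SucI [of _ "\<lambda>x. 1"] times_differentiable_const
        simp del: times_differentiable.simps(2))
qed

lemma smooth_continuous:
  assumes "smooth f"
  shows "continuous_on UNIV f"
  using differentiable_imp_continuous_within [OF smooth_differentiable [OF assms]]
  by (simp add: continuous_on_eq_continuous_within)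

lemma vderiv_compose:
  fixes \<phi> :: "real \<Rightarrow> real"
  assumes "smooth f" "smooth \<phi>"
  shows "vderiv (\<lambda>x. f (\<phi> x)) x = vderiv \<phi> x *\<^sub>R vderiv f (\<phi> x)"
proof -
  have "((f \<circ> \<phi>) has_vector_derivative vderiv \<phi> x *\<^sub>R vderiv f (\<phi> x)) (at x)" for x
    using assms by (intro vector_diff_chain_at has_vderiv smooth_differentiable)
  then have "vderiv (f \<circ> \<phi>) = (\<lambda>x. vderiv \<phi> x *\<^sub>R vderiv f (\<phi> x))"
    by (rule vderivI)
  then show ?thesis by (simp add: o_def fun_eq_iff)
qed

typedef diffeo = "{\<phi> :: real \<Rightarrow> real.
    bij \<phi> \<and> smooth \<phi> \<and> smooth (inv \<phi>) \<and> (\<forall>x. vderiv \<phi> x > 0)}"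
  morphisms diffeo_fun Abs_diffeo
proof
  have "vderiv (\<lambda>x::real. x) = (\<lambda>x. 1)" by (rule vderivI) (rule has_vector_derivative_id)
  moreover have "inv (\<lambda>x::real. x) = (\<lambda>x. x)" by (rule inv_equality) auto
  ultimately show "(\<lambda>x. x) \<in> {\<phi> :: real \<Rightarrow> real.
    bij \<phi> \<and> smooth \<phi> \<and> smooth (inv \<phi>) \<and> (\<forall>x. vderiv \<phi> x > 0)}"
    using bij_id by (simp add: smooth_id id_def)
qed

setup_lifting type_definition_diffeo

lift_definition id_diffeo :: diffeo is "\<lambda>x. x"
proof -
  have "vderiv (\<lambda>x::real. x) = (\<lambda>x. 1)" by (rule vderivI) (rule has_vector_derivative_id)
  moreover have "inv (\<lambda>x::real. x) = (\<lambda>x. x)" by (rule inv_equality) auto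
  ultimately show "?thesis" using bij_id by (simp add: smooth_id id_def)
qed

lift_definition comp_diffeo :: "diffeo \<Rightarrow> diffeo \<Rightarrow> diffeo" is "\<lambda>\<psi> \<phi> x. \<psi> (\<phi> x)"
proof -
  fix \<psi> \<phi> :: "real \<Rightarrow> real"
  assume *: "bij \<psi> \<and> smooth \<psi> \<and> smooth (inv \<psi>) \<and> (\<forall>x. vderiv \<psi> x > 0)"
    "bij \<phi> \<and> smooth \<phi> \<and> smooth (inv \<phi>) \<and> (\<forall>x. vderiv \<phi> x > 0)"
  have "inv (\<lambda>x. \<psi> (\<phi> x)) = (\<lambda>x. inv \<phi> (inv \<psi> x))"
    using * o_inv_distrib [of \<psi> \<phi>] by (simp add: o_def)
  moreover have "bij (\<lambda>x. \<psi> (\<phi> x))"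
    using * bij_comp [of \<phi> \<psi>] by (simp add: o_def)
  ultimately show "bij (\<lambda>x. \<psi> (\<phi> x)) \<and> smooth (\<lambda>x. \<psi> (\<phi> x)) \<and>
      smooth (inv (\<lambda>x. \<psi> (\<phi> x))) \<and> (\<forall>x. vderiv (\<lambda>x. \<psi> (\<phi> x)) x > 0)"
    using * by (simp add: smooth_compose vderiv_compose)
qed


section \<open>The crossed product\<close>

typedef test_fun = "{f :: real \<Rightarrow> complex. smooth f \<and> compact (closure {x. f x \<noteq> 0})}"
  morphisms fun_of Abs_test_fun
  by (rule exI [of _ "\<lambda>x. 0"]) (simp add: smooth_const)

setup_lifting type_definition_test_fun

lemma compact_support_add:
  assumes "compact (closure {x::real. f x \<noteq> 0})" "compact (closure {x. g x \<noteq> 0})"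
  shows "compact (closure {x. f x + g x \<noteq> (0::complex)})"
proof -
  have "bounded ({x. f x \<noteq> 0} \<union> {x. g x \<noteq> 0})" using assms by simp
  then have "bounded {x. f x + g x \<noteq> 0}" by (rule bounded_subset) auto
  then show ?thesis by simp
qed

lemma compact_support_subset:
  assumes "compact (closure {x::real. f x \<noteq> 0})" "\<And>x. f x = 0 \<Longrightarrow> g x = 0"
  shows "compact (closure {x. g x \<noteq> 0})"
proof -
  have "bounded {x. f x \<noteq> 0}" using assms(1) by simp
  then have "bounded {x. g x \<noteq> 0}" by (rule bounded_subset) (use assms(2) in auto)
  then show ?thesis by simp
qed

lemma compact_support_vderiv:
  assumes "compact (closure {x. f x \<noteq> 0})"
  shows "compact (closure {x. vderiv f x \<noteq> 0})"
proof -
  have "vderiv f x = 0" if "x \<in> - closure {x. f x \<noteq> 0}" for x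
  proof -
    have "((\<lambda>x. 0) has_vector_derivative 0) (at x)" by simp
    then have "(f has_vector_derivative 0) (at x)"
      by (rule has_vector_derivative_transform_within_open
          [where S = "- closure {x. f x \<noteq> 0}"])
        (use that in \<open>auto simp: open_Compl intro!: closure_subset [THEN subsetD]\<close>)
    then show ?thesis by (simp add: vderiv_def vector_derivative_at)
  qed
  then have "{x. vderiv f x \<noteq> 0} \<subseteq> closure {x. f x \<noteq> 0}" by auto
  with compact_imp_bounded [OF assms] have "bounded {x. vderiv f x \<noteq> 0}"
    by (rule bounded_subset)
  then show ?thesis by simp
qed

instantiation test_fun :: "{complex_vector, comm_ring}"
begin

lift_definition zero_test_fun :: test_fun is "\<lambda>x. 0"
  by (simp add: smooth_const)

lift_definition plus_test_fun :: "test_fun \<Rightarrow> test_fun \<Rightarrow> test_fun" is "\<lambda>f g x. f x + g x"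
  using compact_support_add smooth_add by blast

lift_definition scaleC_test_fun :: "complex \<Rightarrow> test_fun \<Rightarrow> test_fun" is "\<lambda>c f x. c * f x"
  by (elim conjE, intro conjI smooth_mult smooth_const) (assumption, erule compact_support_subset, simp)

lift_definition uminus_test_fun :: "test_fun \<Rightarrow> test_fun" is "\<lambda>f x. - f x"
proof -
  fix f :: "real \<Rightarrow> complex"
  assume "smooth f \<and> compact (closure {x. f x \<noteq> 0})"
  then show "smooth (\<lambda>x. - f x) \<and> compact (closure {x. - f x \<noteq> 0})"
    using smooth_mult [OF smooth_const [of "-1"], of f] by simp
qed

lift_definition minus_test_fun :: "test_fun \<Rightarrow> test_fun \<Rightarrow> test_fun" is "\<lambda>f g x. f x - g x"
proof -
  fix f g :: "real \<Rightarrow> complex"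
  assume f: "smooth f \<and> compact (closure {x. f x \<noteq> 0})"
    and g: "smooth g \<and> compact (closure {x. g x \<noteq> 0})"
  show "smooth (\<lambda>x. f x - g x) \<and> compact (closure {x. f x - g x \<noteq> 0})"
    using f g smooth_add [of f "\<lambda>x. -1 * g x"] smooth_mult [OF smooth_const [of "-1"], of g]
      compact_support_add [of f "\<lambda>x. - g x"] by simp
qed

lift_definition times_test_fun :: "test_fun \<Rightarrow> test_fun \<Rightarrow> test_fun" is "\<lambda>f g x. f x * g x"
  by (elim conjE, intro conjI smooth_mult)
    (assumption+, erule compact_support_subset, simp)

instance
  by standard (transfer, simp add: fun_eq_iff algebra_simps)+

end

lift_definition tf_deriv :: "test_fun \<Rightarrow> test_fun" is vderiv
  using smooth_vderiv compact_support_vderiv by blast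

lift_definition tf_compose :: "test_fun \<Rightarrow> diffeo \<Rightarrow> test_fun" is "\<lambda>f \<phi> x. f (\<phi> x)"
proof -
  fix f :: "real \<Rightarrow> complex" and \<phi> :: "real \<Rightarrow> real"
  assume f: "smooth f \<and> compact (closure {x. f x \<noteq> 0})"
    and \<phi>: "bij \<phi> \<and> smooth \<phi> \<and> smooth (inv \<phi>) \<and> (\<forall>x. vderiv \<phi> x > 0)"
  have *: "compact (inv \<phi> ` closure {x. f x \<noteq> 0})"
    using f \<phi> by (intro compact_continuous_image) (auto intro: continuous_on_subset smooth_continuous)
  have "{x. f (\<phi> x) \<noteq> 0} \<subseteq> inv \<phi> ` closure {x. f x \<noteq> 0}"
  proof
    fix x assume "x \<in> {x. f (\<phi> x) \<noteq> 0}"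
    then have "\<phi> x \<in> closure {x. f x \<noteq> 0}"
      by (intro closure_subset [THEN subsetD]) simp
    moreover have "inv \<phi> (\<phi> x) = x"
      using \<phi> by (simp add: bij_is_inj)
    ultimately show "x \<in> inv \<phi> ` closure {x. f x \<noteq> 0}"
      by (metis image_eqI)
  qed
  with compact_imp_bounded [OF *] have "bounded {x. f (\<phi> x) \<noteq> 0}"
    by (rule bounded_subset)
  then show "smooth (\<lambda>x. f (\<phi> x)) \<and> compact (closure {x. f (\<phi> x) \<noteq> 0})"
    using f \<phi> by (simp add: smooth_compose)
qed

lift_definition jet_weight :: "nat \<Rightarrow> diffeo \<Rightarrow> test_fun \<Rightarrow> test_fun"
  is "\<lambda>k \<phi> f x. (vderiv ^^ k) \<phi> x *\<^sub>R f x"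
  by (elim conjE, intro conjI smooth_scaleR smooth_vderivs)
    (assumption+, erule compact_support_subset, simp)

lift_definition inverse_weight :: "diffeo \<Rightarrow> test_fun \<Rightarrow> test_fun"
  is "\<lambda>\<phi> f x. inverse (vderiv \<phi> x) *\<^sub>R f x"
proof -
  fix \<phi> :: "real \<Rightarrow> real" and f :: "real \<Rightarrow> complex"
  assume \<phi>: "bij \<phi> \<and> smooth \<phi> \<and> smooth (inv \<phi>) \<and> (\<forall>x. vderiv \<phi> x > 0)"
    and f: "smooth f \<and> compact (closure {x. f x \<noteq> 0})"
  have "smooth (\<lambda>x. inverse (vderiv \<phi> x))"
    using \<phi> by (intro smooth_inverse smooth_vderiv) (auto simp: less_imp_neq [symmetric])
  then show "smooth (\<lambda>x. inverse (vderiv \<phi> x) *\<^sub>R f x) \<and>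
      compact (closure {x. inverse (vderiv \<phi> x) *\<^sub>R f x \<noteq> 0})"
    using f by (elim conjE, intro conjI smooth_scaleR)
      (assumption+, erule compact_support_subset, simp)
qed

text \<open>The element \<open>f\<^sub>1 U\<^sup>*\<^bsub>\<phi>\<^sub>1\<^esub> + f\<^sub>2 U\<^sup>*\<^bsub>\<phi>\<^sub>2\<^esub> + \<dots>\<close> is encoded by its finitely supported coefficient function.\<close>

type_synonym crossed = "diffeo \<Rightarrow>\<^sub>0 test_fun"

definition crossed_mult :: "crossed \<Rightarrow> crossed \<Rightarrow> crossed" (infixl \<open>\<star>\<close> 70)
  where "a \<star> b = (\<Sum>\<phi>\<in>Poly_Mapping.keys a. \<Sum>\<psi>\<in>Poly_Mapping.keys b.
    Poly_Mapping.single (comp_diffeo \<psi> \<phi>)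
      (Poly_Mapping.lookup a \<phi> * tf_compose (Poly_Mapping.lookup b \<psi>) \<phi>))"


section \<open>The algebra \<open>\<K>\<^sub>1\<close> of operators on the crossed product\<close>

lift_definition coefficientwise ::
    "('i \<Rightarrow> 'b::zero \<Rightarrow> 'b) \<Rightarrow> ('i \<Rightarrow>\<^sub>0 'b) \<Rightarrow> 'i \<Rightarrow>\<^sub>0 'b"
  is "\<lambda>F a i. if a i = 0 then 0 else F i (a i)"
  by (erule rev_finite_subset) auto

definition X1_op :: "crossed \<Rightarrow> crossed"
  where "X1_op = coefficientwise (\<lambda>\<phi> f. tf_deriv f)"

definition sigma_op :: "nat \<Rightarrow> crossed \<Rightarrow> crossed"
  where "sigma_op k = coefficientwise (jet_weight k)"

definition sigma_inv_op :: "crossed \<Rightarrow> crossed"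
  where "sigma_inv_op = coefficientwise inverse_weight"

inductive_set K1_ops :: "(crossed \<Rightarrow> crossed) set"
  where
    ident: "(\<lambda>a. a) \<in> K1_ops"
  | X1: "X1_op \<in> K1_ops"
  | sigma: "sigma_op 1 \<in> K1_ops"
  | sigma_inv: "sigma_inv_op \<in> K1_ops"
  | add: "u \<in> K1_ops \<Longrightarrow> v \<in> K1_ops \<Longrightarrow> (\<lambda>a. u a + v a) \<in> K1_ops"
  | scale: "u \<in> K1_ops \<Longrightarrow> (\<lambda>a. c *\<^sub>C u a) \<in> K1_ops"
  | comp: "u \<in> K1_ops \<Longrightarrow> v \<in> K1_ops \<Longrightarrow> (\<lambda>a. u (v a)) \<in> K1_ops"

lemma lookup_coefficientwise:
  "F i 0 = 0 \<Longrightarrow>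
    Poly_Mapping.lookup (coefficientwise F a) i = F i (Poly_Mapping.lookup a i)"
  by (simp add: coefficientwise.rep_eq)

lemma coefficientwise_linear:
  fixes F :: "'i \<Rightarrow> 'b::complex_vector \<Rightarrow> 'b"
  assumes "\<And>i f g. F i (f + g) = F i f + F i g" "\<And>i c f. F i (c *\<^sub>C f) = c *\<^sub>C F i f"
  shows "clinear (coefficientwise F)"
proof -
  have "F i 0 = 0" for i using assms(2) [of i 0 0] by simp
  then show ?thesis
    by (simp add: Vector_Spaces.linear_iff cv.vector_space_axioms poly_mapping_eq_iff fun_eq_iff
        lookup_coefficientwise lookup_add scaleC_poly_mapping.rep_eq assms)
qed

lemma tf_deriv_add: "tf_deriv (f + g) = tf_deriv f + tf_deriv g"
  by transfer
    (auto intro!: vderivI has_vector_derivative_add has_vderiv smooth_differentiable)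

lemma tf_deriv_scaleC: "tf_deriv (c *\<^sub>C f) = c *\<^sub>C tf_deriv f"
  by transfer
    (auto intro!: vderivI has_vector_derivative_mult_right has_vderiv smooth_differentiable)

lemma jet_weight_add: "jet_weight k \<phi> (f + g) = jet_weight k \<phi> f + jet_weight k \<phi> g"
  by transfer (auto simp: scaleR_add_right)

lemma jet_weight_scaleC: "jet_weight k \<phi> (c *\<^sub>C f) = c *\<^sub>C jet_weight k \<phi> f"
  by transfer auto

lemma inverse_weight_add: "inverse_weight \<phi> (f + g) = inverse_weight \<phi> f + inverse_weight \<phi> g"
  by transfer (auto simp: scaleR_add_right)

lemma inverse_weight_scaleC: "inverse_weight \<phi> (c *\<^sub>C f) = c *\<^sub>C inverse_weight \<phi> f"
  by transfer auto

lemma tf_deriv_0: "tf_deriv 0 = 0"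
  using tf_deriv_scaleC [of 0 0] by simp

lemma jet_weight_0: "jet_weight k \<phi> 0 = 0"
  using jet_weight_scaleC [of k \<phi> 0 0] by simp

lemma inverse_weight_0: "inverse_weight \<phi> 0 = 0"
  using inverse_weight_scaleC [of \<phi> 0 0] by simp

lemma lookup_X1_op:
  "Poly_Mapping.lookup (X1_op a) \<phi> = tf_deriv (Poly_Mapping.lookup a \<phi>)"
  by (simp add: X1_op_def lookup_coefficientwise tf_deriv_0)

lemma lookup_sigma_op:
  "Poly_Mapping.lookup (sigma_op k a) \<phi> = jet_weight k \<phi> (Poly_Mapping.lookup a \<phi>)"
  by (simp add: sigma_op_def lookup_coefficientwise jet_weight_0)

lemma lookup_sigma_inv_op:
  "Poly_Mapping.lookup (sigma_inv_op a) \<phi> = inverse_weight \<phi> (Poly_Mapping.lookup a \<phi>)"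
  by (simp add: sigma_inv_op_def lookup_coefficientwise inverse_weight_0)

lemma K1_ops_linear: "u \<in> K1_ops \<Longrightarrow> clinear u"
proof (induction rule: K1_ops.induct)
  case X1 show ?case
    unfolding X1_op_def by (rule coefficientwise_linear) (rule tf_deriv_add tf_deriv_scaleC)+
next
  case sigma show ?case
    unfolding sigma_op_def by (rule coefficientwise_linear) (rule jet_weight_add jet_weight_scaleC)+
next
  case sigma_inv show ?case
    unfolding sigma_inv_op_def
    by (rule coefficientwise_linear) (rule inverse_weight_add inverse_weight_scaleC)+
qed (simp_all add: Vector_Spaces.linear_iff cv.vector_space_axioms scaleC_add_right
    scaleC_scaleC mult.commute algebra_simps)

lemma K1_ops_zero: "(\<lambda>a. 0) \<in> K1_ops"
  using K1_ops.scale [OF K1_ops.ident, of 0] by simp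

lemma K1_ops_uminus: "u \<in> K1_ops \<Longrightarrow> (\<lambda>a. - u a) \<in> K1_ops"
  using K1_ops.scale [of u "-1"] by (simp add: scaleC_one)

lemma K1_ops_diff: "u \<in> K1_ops \<Longrightarrow> v \<in> K1_ops \<Longrightarrow> (\<lambda>a. u a - v a) \<in> K1_ops"
  using K1_ops.add [OF _ K1_ops_uminus, of u v] by simp

lemma sigma_op_Suc: "sigma_op (Suc k) a = X1_op (sigma_op k a) - sigma_op k (X1_op a)"
proof -
  have "jet_weight (Suc k) \<phi> f = tf_deriv (jet_weight k \<phi> f) - jet_weight k \<phi> (tf_deriv f)"
    for \<phi> f
  proof transfer
    fix k and \<phi> :: "real \<Rightarrow> real" and f :: "real \<Rightarrow> complex"
    assume "bij \<phi> \<and> smooth \<phi> \<and> smooth (inv \<phi>) \<and> (\<forall>x. vderiv \<phi> x > 0)"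
      and "smooth f \<and> compact (closure {x. f x \<noteq> 0})"
    then have "smooth ((vderiv ^^ k) \<phi>)" "smooth f" by (auto intro: smooth_vderivs)
    then have "vderiv (\<lambda>x. (vderiv ^^ k) \<phi> x *\<^sub>R f x) =
        (\<lambda>x. (vderiv ^^ k) \<phi> x *\<^sub>R vderiv f x + vderiv ((vderiv ^^ k) \<phi>) x *\<^sub>R f x)"
      by (intro vderivI bounded_bilinear.has_vector_derivative [OF bounded_bilinear_scaleR]
          has_vderiv smooth_differentiable)
    then show "(\<lambda>x. (vderiv ^^ Suc k) \<phi> x *\<^sub>R f x) =
        (\<lambda>x. vderiv (\<lambda>x. (vderiv ^^ k) \<phi> x *\<^sub>R f x) x - (vderiv ^^ k) \<phi> x *\<^sub>R vderiv f x)"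
      by simp
  qed
  then show ?thesis
    by (simp add: poly_mapping_eq_iff fun_eq_iff lookup_minus lookup_X1_op lookup_sigma_op)
qed

lemma sigma_op_in_K1_ops: "sigma_op (Suc k) \<in> K1_ops"
proof (induction k)
  case 0 show ?case using K1_ops.sigma by simp
next
  case (Suc k)
  have "sigma_op (Suc (Suc k)) =
      (\<lambda>a. X1_op (sigma_op (Suc k) a) - sigma_op (Suc k) (X1_op a))"
    by (rule ext) (rule sigma_op_Suc)
  then show ?case
    using K1_ops_diff [OF K1_ops.comp [OF K1_ops.X1 Suc] K1_ops.comp [OF Suc K1_ops.X1]] by simp
qed

typedef K1 = K1_ops
  morphisms op_of Abs_K1
  using K1_ops.ident by blast

setup_lifting type_definition_K1

instantiation K1 :: complex_algebra_1
begin

lift_definition zero_K1 :: K1 is "\<lambda>a. 0" by (rule K1_ops_zero)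
lift_definition one_K1 :: K1 is "\<lambda>a. a" by (rule K1_ops.ident)
lift_definition plus_K1 :: "K1 \<Rightarrow> K1 \<Rightarrow> K1" is "\<lambda>u v a. u a + v a" by (rule K1_ops.add)
lift_definition uminus_K1 :: "K1 \<Rightarrow> K1" is "\<lambda>u a. - u a" by (rule K1_ops_uminus)
lift_definition minus_K1 :: "K1 \<Rightarrow> K1 \<Rightarrow> K1" is "\<lambda>u v a. u a - v a" by (rule K1_ops_diff)
lift_definition scaleC_K1 :: "complex \<Rightarrow> K1 \<Rightarrow> K1" is "\<lambda>c u a. c *\<^sub>C u a" by (rule K1_ops.scale)
lift_definition times_K1 :: "K1 \<Rightarrow> K1 \<Rightarrow> K1" is "\<lambda>u v a. u (v a)" by (rule K1_ops.comp)

instance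
  by (standard; transfer)
    (auto dest!: K1_ops_linear simp: Vector_Spaces.linear_iff scaleC_add_right scaleC_add_left
      scaleC_scaleC scaleC_one algebra_simps)

end

lift_definition X1 :: K1 is X1_op by (rule K1_ops.X1)
lift_definition sigma :: K1 is "sigma_op 1" by (rule K1_ops.sigma)
lift_definition sigma_inv :: K1 is sigma_inv_op by (rule K1_ops.sigma_inv)

text \<open>\<open>sigma_jet k\<close> is \<open>\<sigma>\<^bsub>k+1\<^esub>\<close>, multiplication by the derivative of order \<open>k + 1\<close>.\<close>

lift_definition sigma_jet :: "nat \<Rightarrow> K1" is "\<lambda>k. sigma_op (Suc k)"
  by (rule sigma_op_in_K1_ops)

definition sigma11 :: K1
  where "sigma11 = X1 * sigma - sigma * X1"

lemma sigma11_eq: "sigma11 = sigma_jet 1"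
  unfolding sigma11_def by transfer (auto simp: sigma_op_Suc [of "Suc 0"])


section \<open>Adjoining \<open>log \<sigma>\<close>\<close>

text \<open>
  \<open>\<K>\<^sub>1\<close> with \<open>log \<sigma>\<close> adjoined is the unital algebra over \<open>\<K>\<^sub>1\<close> presented by one further generator
  and the commutation relations: formal expressions modulo the least congruence that
  contains the algebra axioms, makes the inclusion of \<open>\<K>\<^sub>1\<close> a homomorphism, and contains
  these relations.
\<close>

datatype kt_term =
    Inj K1
  | Log
  | Add kt_term kt_term
  | Mult kt_term kt_term
  | Scale complex kt_term

inductive kt_eq :: "kt_term \<Rightarrow> kt_term \<Rightarrow> bool" (infix \<open>\<doteq>\<close> 50)
  where
    refl: "x \<doteq> x"
  | sym: "x \<doteq> y \<Longrightarrow> y \<doteq> x"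
  | trans: "x \<doteq> y \<Longrightarrow> y \<doteq> z \<Longrightarrow> x \<doteq> z"
  | cong_Add: "x \<doteq> x' \<Longrightarrow> y \<doteq> y' \<Longrightarrow> Add x y \<doteq> Add x' y'"
  | cong_Mult: "x \<doteq> x' \<Longrightarrow> y \<doteq> y' \<Longrightarrow> Mult x y \<doteq> Mult x' y'"
  | cong_Scale: "x \<doteq> x' \<Longrightarrow> Scale c x \<doteq> Scale c x'"
  | add_assoc: "Add (Add x y) z \<doteq> Add x (Add y z)"
  | add_commute: "Add x y \<doteq> Add y x"
  | add_zero: "Add (Inj 0) x \<doteq> x"
  | add_inverse: "Add (Scale (-1) x) x \<doteq> Inj 0"
  | scale_add_right: "Scale c (Add x y) \<doteq> Add (Scale c x) (Scale c y)"
  | scale_add_left: "Scale (c + d) x \<doteq> Add (Scale c x) (Scale d x)"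
  | scale_scale: "Scale c (Scale d x) \<doteq> Scale (c * d) x"
  | scale_one: "Scale 1 x \<doteq> x"
  | mult_assoc: "Mult (Mult x y) z \<doteq> Mult x (Mult y z)"
  | mult_one_left: "Mult (Inj 1) x \<doteq> x"
  | mult_one_right: "Mult x (Inj 1) \<doteq> x"
  | distrib_right: "Mult (Add x y) z \<doteq> Add (Mult x z) (Mult y z)"
  | distrib_left: "Mult x (Add y z) \<doteq> Add (Mult x y) (Mult x z)"
  | mult_scale_left: "Mult (Scale c x) y \<doteq> Scale c (Mult x y)"
  | mult_scale_right: "Mult x (Scale c y) \<doteq> Scale c (Mult x y)"
  | Inj_add: "Inj (k + l) \<doteq> Add (Inj k) (Inj l)"
  | Inj_mult: "Inj (k * l) \<doteq> Mult (Inj k) (Inj l)"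
  | Inj_scale: "Inj (c *\<^sub>C k) \<doteq> Scale c (Inj k)"
  | commutator_X1:
      "Add (Mult (Inj X1) Log) (Scale (-1) (Mult Log (Inj X1))) \<doteq> Inj (sigma_inv * sigma11)"
  | commutator_sigma:
      "Add (Mult Log (Inj (sigma_jet n))) (Scale (-1) (Mult (Inj (sigma_jet n)) Log)) \<doteq> Inj 0"

quotient_type K1t = kt_term / kt_eq
  by (rule equivpI) (auto simp: reflp_def symp_def transp_def intro: kt_eq.refl kt_eq.sym kt_eq.trans)

instantiation K1t :: complex_algebra_1
begin

lift_definition zero_K1t :: K1t is "Inj 0" .
lift_definition one_K1t :: K1t is "Inj 1" .
lift_definition plus_K1t :: "K1t \<Rightarrow> K1t \<Rightarrow> K1t" is Add by (rule kt_eq.cong_Add)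
lift_definition times_K1t :: "K1t \<Rightarrow> K1t \<Rightarrow> K1t" is Mult by (rule kt_eq.cong_Mult)
lift_definition scaleC_K1t :: "complex \<Rightarrow> K1t \<Rightarrow> K1t" is Scale by (rule kt_eq.cong_Scale)
lift_definition uminus_K1t :: "K1t \<Rightarrow> K1t" is "Scale (-1)" by (rule kt_eq.cong_Scale)
lift_definition minus_K1t :: "K1t \<Rightarrow> K1t \<Rightarrow> K1t" is "\<lambda>x y. Add x (Scale (-1) y)"
  by (intro kt_eq.cong_Add kt_eq.cong_Scale)

instance
proof
  fix x y z :: K1t and c d :: complex
  show "c *\<^sub>C (x + y) = c *\<^sub>C x + c *\<^sub>C y" by transfer (rule kt_eq.scale_add_right)
  show "(c + d) *\<^sub>C x = c *\<^sub>C x + d *\<^sub>C x" by transfer (rule kt_eq.scale_add_left)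
  show "c *\<^sub>C d *\<^sub>C x = (c * d) *\<^sub>C x" by transfer (rule kt_eq.scale_scale)
  show "1 *\<^sub>C x = x" by transfer (rule kt_eq.scale_one)
  show "x + y + z = x + (y + z)" by transfer (rule kt_eq.add_assoc)
  show "x + y = y + x" by transfer (rule kt_eq.add_commute)
  show "0 + x = x" by transfer (rule kt_eq.add_zero)
  show "- x + x = 0" by transfer (rule kt_eq.add_inverse)
  show "x - y = x + - y" by transfer (rule kt_eq.refl)
  show "x * y * z = x * (y * z)" by transfer (rule kt_eq.mult_assoc)
  show "1 * x = x" by transfer (rule kt_eq.mult_one_left)
  show "x * 1 = x" by transfer (rule kt_eq.mult_one_right)
  show "(x + y) * z = x * z + y * z" by transfer (rule kt_eq.distrib_right)
  show "x * (y + z) = x * y + x * z" by transfer (rule kt_eq.distrib_left)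
  show "(c *\<^sub>C x) * y = c *\<^sub>C (x * y)" by transfer (rule kt_eq.mult_scale_left)
  show "x * (c *\<^sub>C y) = c *\<^sub>C (x * y)" by transfer (rule kt_eq.mult_scale_right)
qed

end

lift_definition inj_K1 :: "K1 \<Rightarrow> K1t" is Inj .
lift_definition log_sigma :: K1t is Log .

lemma inj_K1_zero: "inj_K1 0 = 0" by transfer (rule kt_eq.refl)
lemma inj_K1_one: "inj_K1 1 = 1" by transfer (rule kt_eq.refl)
lemma inj_K1_add: "inj_K1 (k + l) = inj_K1 k + inj_K1 l" by transfer (rule kt_eq.Inj_add)
lemma inj_K1_mult: "inj_K1 (k * l) = inj_K1 k * inj_K1 l" by transfer (rule kt_eq.Inj_mult)
lemma inj_K1_scaleC: "inj_K1 (c *\<^sub>C k) = c *\<^sub>C inj_K1 k" by transfer (rule kt_eq.Inj_scale)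

lemma commutator_X1_log:
  "inj_K1 X1 * log_sigma - log_sigma * inj_K1 X1 = inj_K1 sigma_inv * inj_K1 sigma11"
  unfolding inj_K1_mult [symmetric] by transfer (rule kt_eq.commutator_X1)

lemma commutator_log_sigma:
  "log_sigma * inj_K1 (sigma_jet n) - inj_K1 (sigma_jet n) * log_sigma = 0"
  by transfer (rule kt_eq.commutator_sigma)

text \<open>
  On \<open>\<K>\<^sub>1\<close> the coproduct is determined by
  \<open>k(ab) = k\<^sub>(\<^sub>1\<^sub>)(a) k\<^sub>(\<^sub>2\<^sub>)(b)\<close>, where \<open>ts\<close> lists the pairs \<open>k\<^sub>(\<^sub>1\<^sub>)\<close>, \<open>k\<^sub>(\<^sub>2\<^sub>)\<close>.
  The unit \<open>1 = 1 U\<^sup>*\<^bsub>id\<^esub>\<close> is not compactly supported, so \<open>k(1) = \<epsilon>(k) 1\<close> is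
  imposed locally: on \<open>f U\<^sup>*\<^bsub>id\<^esub>\<close> at the points near which \<open>f\<close> equals 1. The antipode on
  \<open>\<K>\<^sub>1\<close> is determined by the Hopf algebra axioms.
\<close>

definition K1t_hopf_structure ::
    "(K1t \<Rightarrow> K1t tensor) \<Rightarrow> (K1t \<Rightarrow> complex) \<Rightarrow> (K1t \<Rightarrow> K1t) \<Rightarrow> bool"
  where "K1t_hopf_structure \<Delta> \<epsilon> S \<longleftrightarrow>
    hopf_algebra \<Delta> \<epsilon> S \<and>
    (\<forall>k. \<exists>ts. \<Delta> (inj_K1 k) = (\<Sum>(u, v)\<leftarrow>ts. pure_tensor [inj_K1 u, inj_K1 v]) \<and>
      (\<forall>a b. op_of k (a \<star> b) = (\<Sum>(u, v)\<leftarrow>ts. op_of u a \<star> op_of v b))) \<and>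
    (\<forall>k f x. (\<forall>\<^sub>F y in nhds x. fun_of f y = 1) \<longrightarrow>
      fun_of (Poly_Mapping.lookup (op_of k (Poly_Mapping.single id_diffeo f)) id_diffeo) x
        = \<epsilon> (inj_K1 k)) \<and>
    \<Delta> log_sigma = pure_tensor [log_sigma, 1] + pure_tensor [1, log_sigma] \<and>
    \<epsilon> log_sigma = 0 \<and>
    S log_sigma = - log_sigma"

definition GV :: "K1t tensor"
  where "GV =
    pure_tensor [log_sigma, inj_K1 (sigma_inv ^ 2 * sigma11)]
    - pure_tensor [inj_K1 (sigma_inv ^ 2 * sigma11), inj_K1 sigma_inv * log_sigma]"

end

theory Submission
  imports Defs
begin

text \<open>
  Write \<open>\<alpha> = \<sigma>\<^sup>-\<^sup>2 \<sigma>\<^sup>1\<^sub>1\<^sub>,\<^sub>1\<close>. From \<open>\<Delta> \<sigma>\<^sup>1\<^sub>1\<^sub>,\<^sub>1 = \<sigma>\<^sup>1\<^sub>1\<^sub>,\<^sub>1 \<otimes> \<sigma> + \<sigma>\<^sup>2 \<otimes> \<sigma>\<^sup>1\<^sub>1\<^sub>,\<^sub>1\<close>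
  one gets \<open>\<Delta> \<alpha> = \<alpha> \<otimes> \<sigma>\<^sup>-\<^sup>1 + 1 \<otimes> \<alpha>\<close>: the element \<open>\<alpha>\<close> is skew-primitive from \<open>1\<close> to \<open>\<sigma>\<^sup>-\<^sup>1\<close>.
  The primitive element \<open>log \<sigma>\<close> is skew-primitive from \<open>1\<close> to \<open>1\<close>, and \<open>\<sigma>\<^sup>-\<^sup>1 log \<sigma>\<close> from \<open>\<sigma>\<^sup>-\<^sup>1\<close>
  to \<open>\<sigma>\<^sup>-\<^sup>1\<close>. In both \<open>log \<sigma> \<otimes> \<alpha>\<close> and \<open>\<alpha> \<otimes> \<sigma>\<^sup>-\<^sup>1 log \<sigma>\<close> the ends of the factors match, from \<open>1\<close> on
  the left to \<open>\<sigma>\<^sup>-\<^sup>1\<close> on the right, so each is annihilated by \<open>b\<close>. The cyclic operator exchanges the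
  two up to sign and up to terms that cancel in their difference, because \<open>log \<sigma>\<close> commutes with
  \<open>\<sigma>\<close> and \<open>\<alpha>\<close>. This argument makes sense in an arbitrary Hopf algebra with such elements
  (\<open>skew_primitive_cocycle\<close>). The antipode enters through \<open>S (log \<sigma>) = - log \<sigma>\<close> and
  \<open>S \<alpha> = - \<alpha> \<sigma>\<close>; the antipode axiom forces the second equation from the formula for \<open>\<Delta> \<alpha>\<close> and
  \<open>\<epsilon> \<alpha> = 0\<close>, which holds because \<open>\<sigma>\<^sup>1\<^sub>1\<^sub>,\<^sub>1\<close> is a commutator and \<open>\<epsilon>\<close> is a character.

  The remaining point is that the rule \<open>k(ab) = k\<^sub>(\<^sub>1\<^sub>)(a) k\<^sub>(\<^sub>2\<^sub>)(b)\<close> really determines the coproduct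
  on \<open>\<K>\<^sub>1\<close>. This requires that an element \<open>\<Sum> u \<otimes> v\<close> of \<open>\<K>\<^sub>1 \<otimes> \<K>\<^sub>1\<close> vanishes as soon as
  \<open>\<Sum> u(a) v(b) = 0\<close> for all \<open>a\<close> and \<open>b\<close> (\<open>K1_tensor_faithful\<close>). On \<open>a = f U\<^sup>*\<^bsub>\<phi>\<^esub>\<close> and
  \<open>b = g U\<^sup>*\<^bsub>\<psi>\<^esub>\<close> the product evaluates \<open>u(a)\<close> at a point \<open>x\<close> and \<open>v(b)\<close> at the tied point \<open>\<phi>(x)\<close>.
  The operators in \<open>\<K>\<^sub>1\<close> commute with translations, so \<open>b\<close> may be translated until the second
  point is arbitrary. Evaluations at independent points separate the tensor product.
\<close>

section \<open>Linear maps on tensor powers\<close>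

lemma clinearI:
  assumes "\<And>x y. f (x + y) = f x + f y" "\<And>c x. f (c *\<^sub>C x) = c *\<^sub>C f x"
  shows "clinear f"
  using assms by (simp add: Vector_Spaces.linear_iff cv.vector_space_axioms)

lemma clinear_simps:
  assumes "clinear f"
  shows "f (x + y) = f x + f y" "f (c *\<^sub>C x) = c *\<^sub>C f x" "f 0 = 0" "f (- x) = - f x"
    "f (x - y) = f x - f y" "f (sum g A) = (\<Sum>a\<in>A. f (g a))"
    "f (\<Sum>a\<leftarrow>as. h a) = (\<Sum>a\<leftarrow>as. f (h a))"
proof -
  interpret L: Vector_Spaces.linear scaleC scaleC f by (rule assms)
  show "f (x + y) = f x + f y" "f (c *\<^sub>C x) = c *\<^sub>C f x" "f 0 = 0" "f (- x) = - f x"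
    "f (x - y) = f x - f y" "f (sum g A) = (\<Sum>a\<in>A. f (g a))"
    by (simp_all add: L.add L.scale L.zero L.neg L.diff L.sum)
  show "f (\<Sum>a\<leftarrow>as. h a) = (\<Sum>a\<leftarrow>as. f (h a))"
    by (induction as) (simp_all add: L.add L.zero)
qed

lemma multilinear_pure_tensor: "multilinear pure_tensor"
  unfolding multilinear_def
proof (intro allI)
  fix xs ys and x y :: "'a::complex_vector" and c
  have "Poly_Mapping.single (xs @ (c *\<^sub>C x + y) # ys) 1
       - (Poly_Mapping.single (xs @ x # ys) c + Poly_Mapping.single (xs @ y # ys) 1)
      \<in> cv.span multilinear_relations"
    unfolding multilinear_relations_def by (rule cv.span_base) blast
  moreover have "c *\<^sub>C Poly_Mapping.single (xs @ x # ys) (1::complex)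
      = Poly_Mapping.single (xs @ x # ys) c"
    by (rule poly_mapping_eqI)
      (simp add: scaleC_poly_mapping.rep_eq lookup_single when_def scaleC_complex_def)
  ultimately show "pure_tensor (xs @ (c *\<^sub>C x + y) # ys)
      = c *\<^sub>C pure_tensor (xs @ x # ys) + pure_tensor (xs @ y # ys)"
    by (simp add: pure_tensor.abs_eq scaleC_tensor.abs_eq plus_tensor.abs_eq tensor.abs_eq_iff)
qed

lemmas pure_tensor_slot = multilinear_pure_tensor [unfolded multilinear_def, rule_format]

lemma multilinear_prefix: "multilinear f \<Longrightarrow> multilinear (\<lambda>ys. f (xs @ ys))"
  unfolding multilinear_def by (metis append.assoc)

text \<open>
  Linear extension \<open>tlift f t\<close> is a fixed finite linear combination of values of \<open>f\<close>, so it is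
  linear in \<open>f\<close> as well. This gives multilinearity of the outer function in the nested extensions
  that define \<open>\<otimes>\<close> and \<open>\<odot>\<close>.
\<close>

lemma tlift_combination:
  "tlift (\<lambda>xs. c *\<^sub>C f xs + g xs) t = c *\<^sub>C tlift f t + tlift g t"
  by (simp add: tlift_def scaleC_add_right sum.distrib cv.scale_sum_right scaleC_scaleC mult.commute)

lemma multilinear_outer_tlift:
  assumes "\<And>ys. multilinear (\<lambda>xs. F xs ys)"
  shows "multilinear (\<lambda>xs. tlift (F xs) t)"
  unfolding multilinear_def
proof (intro allI)
  fix xs ys x y c
  have "F (xs @ (c *\<^sub>C x + y) # ys) = (\<lambda>zs. c *\<^sub>C F (xs @ x # ys) zs + F (xs @ y # ys) zs)"
    using assms by (auto simp: multilinear_def fun_eq_iff)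
  then show "tlift (F (xs @ (c *\<^sub>C x + y) # ys)) t
      = c *\<^sub>C tlift (F (xs @ x # ys)) t + tlift (F (xs @ y # ys)) t"
    by (simp add: tlift_combination)
qed

lemma clinear_tlift_inner:
  assumes "\<And>xs. multilinear (F xs)"
  shows "clinear (\<lambda>t. tlift (\<lambda>xs. tlift (F xs) t) s)"
  by (intro clinearI)
    (simp_all add: clinear_simps(1,2) [OF tlift_linear [OF assms]] tlift_def [where t = s]
      scaleC_add_right sum.distrib cv.scale_sum_right scaleC_scaleC mult.commute)

lemma multilinear_pure_append: "multilinear (\<lambda>xs. pure_tensor (xs @ ys))"
  by (simp add: multilinear_def pure_tensor_slot)

lemma tcat_pure: "pure_tensor xs \<otimes> pure_tensor ys = pure_tensor (xs @ ys)"
  unfolding tcat_def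
  by (subst tlift_pure)
    (auto intro: multilinear_outer_tlift multilinear_pure_append
      simp: tlift_pure multilinear_prefix multilinear_pure_tensor)

lemma clinear_tcat_left: "clinear (\<lambda>s. s \<otimes> t)"
  unfolding tcat_def
  by (intro tlift_linear multilinear_outer_tlift multilinear_pure_append)

lemma clinear_tcat_right: "clinear (\<lambda>t. s \<otimes> t)"
  unfolding tcat_def
  by (intro clinear_tlift_inner multilinear_prefix multilinear_pure_tensor)

lemma multilinear_map2_left:
  "multilinear (\<lambda>xs. if length xs = length ys then pure_tensor (map2 (*) xs ys) else 0)"
  for ys :: "'a::complex_algebra_1 list"
  unfolding multilinear_def
proof (intro allI)
  fix xs zs :: "'a list" and x y :: 'a and c
  show "(if length (xs @ (c *\<^sub>C x + y) # zs) = length ys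
        then pure_tensor (map2 (*) (xs @ (c *\<^sub>C x + y) # zs) ys) else 0)
      = c *\<^sub>C (if length (xs @ x # zs) = length ys then pure_tensor (map2 (*) (xs @ x # zs) ys) else 0)
        + (if length (xs @ y # zs) = length ys then pure_tensor (map2 (*) (xs @ y # zs) ys) else 0)"
  proof (cases "length ys = length xs + Suc (length zs)")
    case True
    then obtain as b bs where "ys = as @ b # bs" "length as = length xs"
      by (metis append_take_drop_id length_take id_take_nth_drop add_Suc_right le_add1
          less_add_Suc1 min.absorb2)
    then show ?thesis
      using True
      by (simp add: pure_tensor_slot semiring_class.distrib_right mult_scaleC_left)
  qed simp
qed

lemma multilinear_map2_right:
  "multilinear (\<lambda>ys. if length xs = length ys then pure_tensor (map2 (*) xs ys) else 0)"
  for xs :: "'a::complex_algebra_1 list"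
  unfolding multilinear_def
proof (intro allI)
  fix ys zs :: "'a list" and x y :: 'a and c
  show "(if length xs = length (ys @ (c *\<^sub>C x + y) # zs)
        then pure_tensor (map2 (*) xs (ys @ (c *\<^sub>C x + y) # zs)) else 0)
      = c *\<^sub>C (if length xs = length (ys @ x # zs) then pure_tensor (map2 (*) xs (ys @ x # zs)) else 0)
        + (if length xs = length (ys @ y # zs) then pure_tensor (map2 (*) xs (ys @ y # zs)) else 0)"
  proof (cases "length xs = length ys + Suc (length zs)")
    case True
    then obtain as b bs where "xs = as @ b # bs" "length as = length ys"
      by (metis append_take_drop_id length_take id_take_nth_drop add_Suc_right le_add1
          less_add_Suc1 min.absorb2)
    then show ?thesis
      using True
      by (simp add: pure_tensor_slot semiring_class.distrib_left mult_scaleC_right)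
  qed simp
qed

lemma tmul_pure:
  assumes "length xs = length ys"
  shows "pure_tensor xs \<odot> pure_tensor ys = pure_tensor (map2 (*) xs ys)"
  unfolding tmul_def tlift_pure [OF multilinear_map2_right] tlift_pure [OF multilinear_map2_left]
  using assms by simp

lemma clinear_tmul_left: "clinear (\<lambda>s. s \<odot> t)"
  unfolding tmul_def
  by (intro tlift_linear multilinear_outer_tlift multilinear_map2_left)

lemma clinear_tmul_right: "clinear (\<lambda>t. s \<odot> t)"
  unfolding tmul_def by (intro clinear_tlift_inner multilinear_map2_right)

lemma multilinear_at_factor:
  assumes F: "clinear F"
  shows "multilinear (\<lambda>xs. if i < length xs
      then pure_tensor (take i xs) \<otimes> F (xs ! i) \<otimes> pure_tensor (drop (Suc i) xs) else 0)"
  unfolding multilinear_def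
proof (intro allI)
  fix xs ys :: "'a list" and x y :: 'a and c
  note lin = clinear_simps(1,2) [OF clinear_tcat_left] clinear_simps(1,2) [OF clinear_tcat_right]
    clinear_simps(1,2) [OF F]
  consider "i < length xs" | "i = length xs" | j where "i = length xs + Suc j"
    by (metis add_Suc_right less_imp_Suc_add nat_neq_iff)
  then show "(if i < length (xs @ (c *\<^sub>C x + y) # ys)
       then pure_tensor (take i (xs @ (c *\<^sub>C x + y) # ys)) \<otimes>
         F ((xs @ (c *\<^sub>C x + y) # ys) ! i) \<otimes> pure_tensor (drop (Suc i) (xs @ (c *\<^sub>C x + y) # ys))
       else 0) =
      c *\<^sub>C (if i < length (xs @ x # ys)
        then pure_tensor (take i (xs @ x # ys)) \<otimes> F ((xs @ x # ys) ! i) \<otimes>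
          pure_tensor (drop (Suc i) (xs @ x # ys)) else 0) +
      (if i < length (xs @ y # ys)
        then pure_tensor (take i (xs @ y # ys)) \<otimes> F ((xs @ y # ys) ! i) \<otimes>
          pure_tensor (drop (Suc i) (xs @ y # ys)) else 0)"
  proof cases
    case 1
    then show ?thesis by (simp add: pure_tensor_slot lin nth_append)
  next
    case 2
    then show ?thesis by (simp add: lin)
  next
    case 3
    then show ?thesis by (simp add: pure_tensor_slot lin nth_append)
  qed
qed

lemma at_factor_pure:
  assumes "clinear F" "i < length xs"
  shows "at_factor i F (pure_tensor xs)
    = pure_tensor (take i xs) \<otimes> F (xs ! i) \<otimes> pure_tensor (drop (Suc i) xs)"
  unfolding at_factor_def
  by (subst tlift_pure [OF multilinear_at_factor [OF assms(1)]]) (simp add: assms(2))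

lemma clinear_at_factor: "clinear F \<Longrightarrow> clinear (at_factor i F)"
  unfolding at_factor_def by (intro tlift_linear multilinear_at_factor)

lemma multilinear_bilinear:
  fixes \<beta> :: "'a::complex_vector \<Rightarrow> 'a \<Rightarrow> 'b::complex_vector"
  assumes "\<And>x. clinear (\<beta> x)" "\<And>y. clinear (\<lambda>x. \<beta> x y)"
  shows "multilinear (\<lambda>xs. case xs of [x, y] \<Rightarrow> \<beta> x y | _ \<Rightarrow> 0)"
  unfolding multilinear_def
proof (intro allI)
  fix xs ys :: "'a list" and x y c
  note lin = clinear_simps(1,2) [OF assms(1)] clinear_simps(1,2) [OF assms(2)]
  show "(case xs @ (c *\<^sub>C x + y) # ys of [x, y] \<Rightarrow> \<beta> x y | _ \<Rightarrow> 0) =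
    c *\<^sub>C (case xs @ x # ys of [x, y] \<Rightarrow> \<beta> x y | _ \<Rightarrow> 0) +
    (case xs @ y # ys of [x, y] \<Rightarrow> \<beta> x y | _ \<Rightarrow> 0)"
    by (cases xs; cases "tl xs") (auto simp: lin split: list.split)
qed

lemma clinear_slot:
  assumes "multilinear f"
  shows "clinear (\<lambda>x. f (xs @ x # ys))"
proof (rule clinearI)
  note f = assms [unfolded multilinear_def, rule_format]
  have "f (xs @ 0 # ys) = 0"
    using f [of xs 1 0 0 ys] by (simp add: scaleC_one)
  then show "f (xs @ (c *\<^sub>C x) # ys) = c *\<^sub>C f (xs @ x # ys)" for c x
    using f [of xs c x 0 ys] by simp
  show "f (xs @ (x + y) # ys) = f (xs @ x # ys) + f (xs @ y # ys)" for x y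
    using f [of xs 1 x y ys] by (simp add: scaleC_one)
qed

section \<open>Vanishing of tensors\<close>

text \<open>
  A criterion for \<open>\<Sum> u \<otimes> v = 0\<close>, phrased for every bilinear image of that tensor. Expanding the second
  factors in a basis rewrites the tensor as \<open>\<Sum> w\<^sub>b \<otimes> b\<close> over finitely many basis vectors \<open>b\<close>. A
  functional \<open>L\<close> on the first factor gives \<open>\<Sum> L(w\<^sub>b) b = 0\<close>, hence \<open>L(w\<^sub>b) = 0\<close>, and the
  functionals in \<open>\<Lambda>\<close> separate points.
\<close>

lemma bilinear_sum_eq_0:
  fixes \<beta> :: "'a::complex_vector \<Rightarrow> 'b::complex_vector \<Rightarrow> 'c::complex_vector"
    and \<Lambda> :: "('a \<Rightarrow> complex) set"
  assumes \<beta>: "\<And>x. clinear (\<beta> x)" "\<And>y. clinear (\<lambda>x. \<beta> x y)"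
    and \<Lambda>: "\<And>L. L \<in> \<Lambda> \<Longrightarrow> clinear L" "\<And>u. (\<And>L. L \<in> \<Lambda> \<Longrightarrow> L u = 0) \<Longrightarrow> u = 0"
    and 0: "\<And>L. L \<in> \<Lambda> \<Longrightarrow> (\<Sum>(u, v)\<leftarrow>ts. L u *\<^sub>C v) = 0"
  shows "(\<Sum>(u, v)\<leftarrow>ts. \<beta> u v) = 0"
proof -
  define B :: "'b set" where "B = cv.extend_basis {}"
  have B: "cv.independent B" "cv.span B = UNIV"
    by (simp_all add: B_def cv.independent_extend_basis cv.span_extend_basis cv.independent_empty)
  define r where "r = cv.representation B"
  define K where "K = (\<Union>(u, v)\<in>set ts. {b. r v b \<noteq> 0})"
  have K: "finite K" "K \<subseteq> B"
    using cv.representation_ne_zero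
    by (auto simp: K_def r_def cv.finite_representation)
  have v: "v = (\<Sum>b\<in>K. r v b *\<^sub>C b)" if "(u, v) \<in> set ts" for u v
    unfolding r_def
    using cv.sum_nonzero_representation_eq [of B v] B K that
    by (subst sum.mono_neutral_right [of K "{b. cv.representation B v b \<noteq> 0}"])
      (auto simp: K_def r_def)
  define w where "w b = (\<Sum>(u, v)\<leftarrow>ts. r v b *\<^sub>C u)" for b
  have regroup: "(\<Sum>(u, v)\<leftarrow>ts. \<gamma> u v) = (\<Sum>b\<in>K. \<gamma> (w b) b)"
    if \<gamma>: "\<And>x. clinear (\<gamma> x)" "\<And>y. clinear (\<lambda>x. \<gamma> x y)"
    for \<gamma> :: "'a \<Rightarrow> 'b \<Rightarrow> 'd::complex_vector"
  proof -
    have "\<gamma> u v = (\<Sum>b\<in>K. r v b *\<^sub>C \<gamma> u b)" if "(u, v) \<in> set ts" for u v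
      by (subst v [OF that]) (simp add: clinear_simps [OF \<gamma>(1)])
    then have "(\<Sum>(u, v)\<leftarrow>ts. \<gamma> u v) = (\<Sum>(u, v)\<leftarrow>ts. \<Sum>b\<in>K. r v b *\<^sub>C \<gamma> u b)"
      by (intro arg_cong [of _ _ sum_list] map_cong) auto
    also have "\<dots> = (\<Sum>b\<in>K. \<Sum>(u, v)\<leftarrow>ts. r v b *\<^sub>C \<gamma> u b)"
      by (induction ts) (auto simp: sum.distrib)
    also have "\<dots> = (\<Sum>b\<in>K. \<gamma> (w b) b)"
      by (simp add: w_def clinear_simps [OF \<gamma>(2)] case_prod_unfold)
    finally show ?thesis .
  qed
  \<comment> \<open>Regrouping for \<open>\<gamma> u v = L u \<cdot> v\<close> turns the hypothesis into a relation between basis vectors.\<close>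
  have "w b = 0" if "b \<in> K" for b
  proof (rule \<Lambda>(2))
    fix L assume L: "L \<in> \<Lambda>"
    have "(\<Sum>b\<in>K. L (w b) *\<^sub>C b) = 0"
      using 0 [OF L] regroup [of "\<lambda>u v. L u *\<^sub>C v"] clinear_simps(1,2) [OF \<Lambda>(1) [OF L]]
      by (simp add: clinearI scaleC_add_right scaleC_add_left scaleC_scaleC scaleC_complex_def
          mult.commute)
    then show "L (w b) = 0"
      using cv.independentD [OF B(1) K, of "\<lambda>b. L (w b)"] that by blast
  qed
  then show ?thesis
    using regroup [OF \<beta>] by (simp add: clinear_simps [OF \<beta>(2)])
qed


section \<open>Operators on the crossed product\<close>

text \<open>
  All operators in \<open>\<K>\<^sub>1\<close> act on each summand \<open>f U\<^sup>*\<^bsub>\<phi>\<^esub>\<close> separately, since the generators do.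
\<close>

lemma K1_ops_local:
  "u \<in> K1_ops \<Longrightarrow> Poly_Mapping.lookup (u a) \<phi>
    = Poly_Mapping.lookup (u (Poly_Mapping.single \<phi> (Poly_Mapping.lookup a \<phi>))) \<phi>"
proof (induction arbitrary: a rule: K1_ops.induct)
  case (comp u v)
  show ?case using comp.IH by metis
qed (simp_all add: lookup_X1_op lookup_sigma_op lookup_sigma_inv_op lookup_add
    scaleC_poly_mapping.rep_eq)

lift_definition shift_diffeo :: "real \<Rightarrow> diffeo" is "\<lambda>c x. x + c"
proof -
  fix c :: real
  have "vderiv (\<lambda>x. x + c) = (\<lambda>x. 1)"
    by (rule vderivI) (auto intro!: derivative_eq_intros)
  moreover have "inv (\<lambda>x. x + c) = (\<lambda>x. x + - c)" by (rule inv_equality) auto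
  moreover have "bij (\<lambda>x. x + c)" by (rule bijI') (auto intro: exI [of _ "_ - c"] diff_add_cancel [symmetric])
  ultimately show "bij (\<lambda>x. x + c) \<and> smooth (\<lambda>x. x + c) \<and> smooth (inv (\<lambda>x. x + c)) \<and>
      (\<forall>x. vderiv (\<lambda>x. x + c) x > 0)"
    by (simp only:) (simp add: smooth_add smooth_id smooth_const del: add_uminus_conv_diff)
qed

lemma vderiv_shift: "smooth f \<Longrightarrow> vderiv (\<lambda>x. f (x + c)) = (\<lambda>x. vderiv f (x + c))"
proof -
  assume f: "smooth f"
  have 1: "vderiv (\<lambda>x. x + c) = (\<lambda>x. 1)"
    by (rule vderivI) (auto intro!: derivative_eq_intros)
  show ?thesis
    using vderiv_compose [OF f, of "\<lambda>x. x + c"] by (simp add: fun_eq_iff 1 smooth_add smooth_id smooth_const)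
qed

text \<open>
  With \<open>T x = x + c\<close>, replacing \<open>g U\<^sup>*\<^bsub>\<psi>\<^esub>\<close> by \<open>(g \<circ> T) U\<^sup>*\<^bsub>\<psi> \<circ> T\<^esub>\<close> commutes with the generators
  because \<open>T' = 1\<close>: both the derivative of \<open>g \<circ> T\<close> and the weight \<open>(\<psi> \<circ> T)'\<close> are translates.
\<close>

lemma K1_ops_translation:
  assumes "u \<in> K1_ops"
  shows "Poly_Mapping.lookup (u (Poly_Mapping.single (comp_diffeo \<psi> (shift_diffeo c))
      (tf_compose g (shift_diffeo c)))) (comp_diffeo \<psi> (shift_diffeo c))
    = tf_compose (Poly_Mapping.lookup (u (Poly_Mapping.single \<psi> g)) \<psi>) (shift_diffeo c)"
  using assms
proof (induction arbitrary: g rule: K1_ops.induct)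
  case X1
  have "tf_deriv (tf_compose g (shift_diffeo c)) = tf_compose (tf_deriv g) (shift_diffeo c)"
    by transfer (simp add: vderiv_shift)
  then show ?case by (simp add: lookup_X1_op)
next
  case sigma
  have "jet_weight 1 (comp_diffeo \<psi> (shift_diffeo c)) (tf_compose g (shift_diffeo c))
      = tf_compose (jet_weight 1 \<psi> g) (shift_diffeo c)"
    by transfer (simp add: vderiv_shift)
  then show ?case by (simp add: lookup_sigma_op)
next
  case sigma_inv
  have "inverse_weight (comp_diffeo \<psi> (shift_diffeo c)) (tf_compose g (shift_diffeo c))
      = tf_compose (inverse_weight \<psi> g) (shift_diffeo c)"
    by transfer (simp add: vderiv_shift)
  then show ?case by (simp add: lookup_sigma_inv_op)
next
  case (add u v)
  have "tf_compose (f + h) \<phi> = tf_compose f \<phi> + tf_compose h \<phi>" for f h \<phi>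
    by transfer simp
  with add show ?case by (simp add: lookup_add)
next
  case (scale u k)
  have "tf_compose (k *\<^sub>C f) \<phi> = k *\<^sub>C tf_compose f \<phi>" for f \<phi>
    by transfer simp
  with scale show ?case by (simp add: scaleC_poly_mapping.rep_eq)
next
  case (comp u v)
  show ?case
    by (subst K1_ops_local [OF comp.hyps(1)], subst (2) K1_ops_local [OF comp.hyps(1)])
      (simp only: comp.IH)
qed simp

definition K1_coeff :: "K1 \<Rightarrow> diffeo \<Rightarrow> test_fun \<Rightarrow> test_fun"
  where "K1_coeff u \<phi> f = Poly_Mapping.lookup (op_of u (Poly_Mapping.single \<phi> f)) \<phi>"

lemma lookup_op_of: "Poly_Mapping.lookup (op_of u a) \<phi> = K1_coeff u \<phi> (Poly_Mapping.lookup a \<phi>)"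
  unfolding K1_coeff_def by (rule K1_ops_local) (rule op_of)

lemma K1_coeff_zero: "K1_coeff u \<phi> 0 = 0"
proof -
  interpret L: Vector_Spaces.linear scaleC scaleC "op_of u"
    by (rule K1_ops_linear) (rule op_of)
  show ?thesis by (simp add: K1_coeff_def L.zero)
qed

lemma op_of_single: "op_of u (Poly_Mapping.single \<phi> f) = Poly_Mapping.single \<phi> (K1_coeff u \<phi> f)"
  by (rule poly_mapping_eqI) (simp add: lookup_op_of lookup_single when_def K1_coeff_zero)

lemma K1_coeff_shift:
  "K1_coeff v (comp_diffeo \<psi> (shift_diffeo c)) (tf_compose g (shift_diffeo c))
    = tf_compose (K1_coeff v \<psi> g) (shift_diffeo c)"
  unfolding K1_coeff_def by (rule K1_ops_translation) (rule op_of)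

lemma K1_eq_0I:
  assumes "\<And>\<phi> f x. fun_of (K1_coeff u \<phi> f) x = 0"
  shows "u = 0"
proof -
  have "K1_coeff u \<phi> f = 0" for \<phi> f
    using assms by (simp add: fun_of_inject [symmetric] zero_test_fun.rep_eq fun_eq_iff)
  then have "op_of u a = 0" for a
    by (intro poly_mapping_eqI) (simp add: lookup_op_of)
  then show ?thesis
    by (simp add: op_of_inject [symmetric] zero_K1.rep_eq fun_eq_iff)
qed

lemma crossed_mult_superset:
  assumes "finite A" "Poly_Mapping.keys a \<subseteq> A" "finite B" "Poly_Mapping.keys b \<subseteq> B"
  shows "a \<star> b = (\<Sum>\<phi>\<in>A. \<Sum>\<psi>\<in>B. Poly_Mapping.single (comp_diffeo \<psi> \<phi>)
      (Poly_Mapping.lookup a \<phi> * tf_compose (Poly_Mapping.lookup b \<psi>) \<phi>))"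
proof -
  have "tf_compose 0 \<phi> = 0" for \<phi> by transfer simp
  then have "(\<Sum>\<psi>\<in>B. Poly_Mapping.single (comp_diffeo \<psi> \<phi>)
        (Poly_Mapping.lookup a \<phi> * tf_compose (Poly_Mapping.lookup b \<psi>) \<phi>))
      = (\<Sum>\<psi>\<in>Poly_Mapping.keys b. Poly_Mapping.single (comp_diffeo \<psi> \<phi>)
        (Poly_Mapping.lookup a \<phi> * tf_compose (Poly_Mapping.lookup b \<psi>) \<phi>))" for \<phi>
    using assms(3,4) by (intro sum.mono_neutral_right) (auto simp: in_keys_iff)
  then show ?thesis
    unfolding crossed_mult_def using assms(1,2)
    by (simp only:) (intro sum.mono_neutral_left, auto simp: in_keys_iff)
qed

lemma crossed_mult_single:
  "Poly_Mapping.single \<phi> f \<star> Poly_Mapping.single \<psi> g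
    = Poly_Mapping.single (comp_diffeo \<psi> \<phi>) (f * tf_compose g \<phi>)"
  by (subst crossed_mult_superset [of "{\<phi>}" _ "{\<psi>}"]) auto

lemma coefficientwise_mult:
  assumes "\<And>\<phi>. F \<phi> 0 = 0" "\<And>\<phi>. G \<phi> 0 = 0"
  shows "coefficientwise F a \<star> coefficientwise G b
    = (\<Sum>\<phi>\<in>Poly_Mapping.keys a. \<Sum>\<psi>\<in>Poly_Mapping.keys b. Poly_Mapping.single (comp_diffeo \<psi> \<phi>)
      (F \<phi> (Poly_Mapping.lookup a \<phi>) * tf_compose (G \<psi> (Poly_Mapping.lookup b \<psi>)) \<phi>))"
  by (subst crossed_mult_superset [of "Poly_Mapping.keys a" _ "Poly_Mapping.keys b"])
    (auto simp: in_keys_iff lookup_coefficientwise assms)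

lemma coefficientwise_of_mult:
  assumes "\<And>\<phi> f g. H \<phi> (f + g) = H \<phi> f + H \<phi> g"
  shows "coefficientwise H (a \<star> b)
    = (\<Sum>\<phi>\<in>Poly_Mapping.keys a. \<Sum>\<psi>\<in>Poly_Mapping.keys b. Poly_Mapping.single (comp_diffeo \<psi> \<phi>)
      (H (comp_diffeo \<psi> \<phi>)
        (Poly_Mapping.lookup a \<phi> * tf_compose (Poly_Mapping.lookup b \<psi>) \<phi>)))"
proof -
  have H0: "H \<phi> 0 = 0" for \<phi> using assms [of \<phi> 0 0] by simp
  then have 0: "coefficientwise H 0 = 0"
    by (intro poly_mapping_eqI) (simp add: lookup_coefficientwise)
  have add: "coefficientwise H (p + q) = coefficientwise H p + coefficientwise H q" for p q
    by (rule poly_mapping_eqI) (simp add: lookup_coefficientwise H0 lookup_add assms)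
  have sum: "coefficientwise H (sum h I) = (\<Sum>i\<in>I. coefficientwise H (h i))"
    for h :: "diffeo \<Rightarrow> crossed" and I
    by (induction I rule: infinite_finite_induct) (simp_all add: 0 add)
  have "coefficientwise H (Poly_Mapping.single \<theta> f) = Poly_Mapping.single \<theta> (H \<theta> f)" for \<theta> f
    by (rule poly_mapping_eqI) (simp add: lookup_coefficientwise H0 lookup_single when_def)
  then show ?thesis by (simp add: crossed_mult_def sum)
qed

section \<open>Product rules for \<open>\<sigma>\<close>, \<open>\<sigma>\<^sup>-\<^sup>1\<close> and \<open>\<sigma>\<^sub>2\<close>\<close>

text \<open>
  The chain rule \<open>(\<psi> \<circ> \<phi>)' = \<phi>' (\<psi>' \<circ> \<phi>)\<close> makes \<open>\<sigma>\<close>, and likewise its inverse, multiplicative.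
\<close>

lemma sigma_op_mult: "sigma_op 1 (a \<star> b) = sigma_op 1 a \<star> sigma_op 1 b"
proof -
  have "jet_weight 1 (comp_diffeo \<psi> \<phi>) (f * tf_compose g \<phi>)
      = jet_weight 1 \<phi> f * tf_compose (jet_weight 1 \<psi> g) \<phi>" for \<phi> \<psi> f g
    by transfer (simp add: vderiv_compose fun_eq_iff)
  then show ?thesis
    unfolding sigma_op_def
    by (subst coefficientwise_of_mult coefficientwise_mult; simp add: jet_weight_add jet_weight_0)+
qed

lemma sigma_inv_op_mult: "sigma_inv_op (a \<star> b) = sigma_inv_op a \<star> sigma_inv_op b"
proof -
  have "inverse_weight (comp_diffeo \<psi> \<phi>) (f * tf_compose g \<phi>)
      = inverse_weight \<phi> f * tf_compose (inverse_weight \<psi> g) \<phi>" for \<phi> \<psi> f g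
    by transfer (simp add: vderiv_compose fun_eq_iff)
  then show ?thesis
    unfolding sigma_inv_op_def
    by (simp add: coefficientwise_of_mult coefficientwise_mult inverse_weight_add inverse_weight_0)
qed

lemma vderiv_vderiv_compose:
  fixes \<phi> \<psi> :: "real \<Rightarrow> real"
  assumes "smooth \<psi>" "smooth \<phi>"
  shows "vderiv (vderiv (\<lambda>x. \<psi> (\<phi> x))) x
    = vderiv (vderiv \<phi>) x * vderiv \<psi> (\<phi> x) + vderiv \<phi> x * vderiv \<phi> x * vderiv (vderiv \<psi>) (\<phi> x)"
proof -
  have "vderiv (\<lambda>x. \<psi> (\<phi> x)) = (\<lambda>x. vderiv \<phi> x * vderiv \<psi> (\<phi> x))"
    using vderiv_compose [OF assms] by (simp add: fun_eq_iff)
  moreover have "vderiv (\<lambda>x. vderiv \<phi> x * vderiv \<psi> (\<phi> x))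
      = (\<lambda>x. vderiv \<phi> x * vderiv (\<lambda>x. vderiv \<psi> (\<phi> x)) x + vderiv (vderiv \<phi>) x * vderiv \<psi> (\<phi> x))"
    using smooth_vderiv [OF assms(2)] smooth_compose [OF smooth_vderiv [OF assms(1)] assms(2)]
    by (intro vderivI(1) has_vector_derivative_mult)
      (simp_all add: has_vderiv smooth_differentiable)
  ultimately show ?thesis
    using vderiv_compose [OF smooth_vderiv [OF assms(1)] assms(2)] by simp
qed

text \<open>
  The two terms come from the second-order chain rule
  \<open>(\<psi> \<circ> \<phi>)'' = \<phi>'' (\<psi>' \<circ> \<phi>) + (\<phi>')\<^sup>2 (\<psi>'' \<circ> \<phi>)\<close>.
\<close>

lemma sigma_op_2_mult:
  "sigma_op 2 (a \<star> b) = sigma_op 2 a \<star> sigma_op 1 b + sigma_op 1 (sigma_op 1 a) \<star> sigma_op 2 b"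
proof -
  have "jet_weight 2 (comp_diffeo \<psi> \<phi>) (f * tf_compose g \<phi>)
      = jet_weight 2 \<phi> f * tf_compose (jet_weight 1 \<psi> g) \<phi>
        + jet_weight 1 \<phi> (jet_weight 1 \<phi> f) * tf_compose (jet_weight 2 \<psi> g) \<phi>" for \<phi> \<psi> f g
    by transfer
      (simp add: vderiv_vderiv_compose fun_eq_iff numeral_2_eq_2 scaleR_conv_of_real algebra_simps)
  moreover have "coefficientwise (jet_weight 1) (coefficientwise (jet_weight 1) a)
      = coefficientwise (\<lambda>\<phi> f. jet_weight 1 \<phi> (jet_weight 1 \<phi> f)) a"
    by (rule poly_mapping_eqI) (simp add: lookup_coefficientwise jet_weight_0)
  ultimately show ?thesis
    unfolding sigma_op_def
    by (simp add: coefficientwise_of_mult coefficientwise_mult jet_weight_add jet_weight_0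
        single_add sum.distrib)
qed


section \<open>Faithfulness and the coproduct on \<open>\<K>\<^sub>1\<close>\<close>

lemma K1_coeff_linear: "clinear (\<lambda>u. fun_of (K1_coeff u \<phi> f) x)"
  by (rule clinearI)
    (simp_all add: K1_coeff_def plus_K1.rep_eq scaleC_K1.rep_eq lookup_add plus_test_fun.rep_eq
      scaleC_poly_mapping.rep_eq scaleC_test_fun.rep_eq scaleC_complex_def)

text \<open>
  Evaluating \<open>u(f U\<^sup>*\<^bsub>\<phi>\<^esub>) v(g U\<^sup>*\<^bsub>\<psi>\<^esub>)\<close> at \<open>x\<close> couples the value of the first factor at \<open>x\<close> with that
  of the second at \<open>\<phi>(x)\<close>. Translating \<open>g U\<^sup>*\<^bsub>\<psi>\<^esub>\<close> by \<open>y - \<phi>(x)\<close> decouples the two points, and the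
  point evaluations of coefficients separate \<open>\<K>\<^sub>1\<close>.
\<close>

lemma K1_tensor_faithful:
  fixes \<beta> :: "K1 \<Rightarrow> K1 \<Rightarrow> 'c::complex_vector"
  assumes \<beta>: "\<And>u. clinear (\<beta> u)" "\<And>v. clinear (\<lambda>u. \<beta> u v)"
    and 0: "\<And>a b. (\<Sum>(u, v)\<leftarrow>ts. op_of u a \<star> op_of v b) = 0"
  shows "(\<Sum>(u, v)\<leftarrow>ts. \<beta> u v) = 0"
proof (rule bilinear_sum_eq_0 [OF \<beta>, of "{L. \<exists>\<phi> f x. L = (\<lambda>u. fun_of (K1_coeff u \<phi> f) x)}"])
  have diagonal: "(\<Sum>(u, v)\<leftarrow>ts. fun_of (K1_coeff u \<phi> f) x * fun_of (K1_coeff v \<psi> g) (diffeo_fun \<phi> x)) = 0"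
    for \<phi> \<psi> f g x
  proof -
    define \<theta> where "\<theta> = comp_diffeo \<psi> \<phi>"
    have eval: "fun_of (Poly_Mapping.lookup (sum_list ps) \<theta>) x
        = (\<Sum>p\<leftarrow>ps. fun_of (Poly_Mapping.lookup p \<theta>) x)" for ps :: "crossed list"
      by (induction ps) (simp_all add: lookup_add plus_test_fun.rep_eq zero_test_fun.rep_eq)
    have "0 = fun_of (Poly_Mapping.lookup (\<Sum>(u, v)\<leftarrow>ts. op_of u (Poly_Mapping.single \<phi> f) \<star>
        op_of v (Poly_Mapping.single \<psi> g)) \<theta>) x"
      by (simp add: 0 zero_test_fun.rep_eq)
    also have "\<dots> = (\<Sum>(u, v)\<leftarrow>ts. fun_of (K1_coeff u \<phi> f) x * fun_of (K1_coeff v \<psi> g) (diffeo_fun \<phi> x))"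
      unfolding eval
      by (simp add: o_def case_prod_unfold op_of_single crossed_mult_single \<theta>_def [symmetric]
          times_test_fun.rep_eq tf_compose.rep_eq)
    finally show ?thesis by simp
  qed
  have independent: "(\<Sum>(u, v)\<leftarrow>ts. fun_of (K1_coeff u \<phi> f) x * fun_of (K1_coeff v \<psi> g) y) = 0"
    for \<phi> \<psi> f g x y
    using diagonal [of \<phi> f x "comp_diffeo \<psi> (shift_diffeo (y - diffeo_fun \<phi> x))"
        "tf_compose g (shift_diffeo (y - diffeo_fun \<phi> x))"]
    by (simp add: K1_coeff_shift tf_compose.rep_eq shift_diffeo.rep_eq)
  show "(\<Sum>(u, v)\<leftarrow>ts. L u *\<^sub>C v) = 0"
    if L: "L \<in> {L. \<exists>\<phi> f x. L = (\<lambda>u. fun_of (K1_coeff u \<phi> f) x)}" for L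
  proof (rule K1_eq_0I)
    fix \<psi> g y
    show "fun_of (K1_coeff (\<Sum>(u, v)\<leftarrow>ts. L u *\<^sub>C v) \<psi> g) y = 0"
      using L independent
      by (auto simp: clinear_simps [OF K1_coeff_linear] case_prod_unfold scaleC_complex_def)
  qed
qed (use K1_coeff_linear K1_eq_0I in blast)+

lemma clinear_pure_tensor2:
  assumes "clinear f"
  shows "clinear (\<lambda>u. pure_tensor [f u, y])" "clinear (\<lambda>v. pure_tensor [x, f v])"
  using clinear_slot [OF multilinear_pure_tensor, of "[]" "[y]"]
    clinear_slot [OF multilinear_pure_tensor, of "[x]" "[]"]
  by (auto intro!: clinearI simp: clinear_simps [OF assms] dest: clinear_simps(1,2))

lemma clinear_inj_K1: "clinear inj_K1"
  by (rule clinearI) (simp_all add: inj_K1_add inj_K1_scaleC)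

text \<open>
  The prescribed coproduct comes with some representation by pairs that satisfies the product rule of
  \<open>k\<close>. Its difference with the given representation acts as zero on all pairs, so faithfulness
  identifies the two.
\<close>

lemma coproduct_from_leibniz:
  assumes "K1t_hopf_structure \<Delta> \<epsilon> S"
    and leibniz: "\<And>a b. op_of k (a \<star> b) = (\<Sum>(u, v)\<leftarrow>ts. op_of u a \<star> op_of v b)"
  shows "\<Delta> (inj_K1 k) = (\<Sum>(u, v)\<leftarrow>ts. pure_tensor [inj_K1 u, inj_K1 v])"
proof -
  obtain ts' where ts': "\<Delta> (inj_K1 k) = (\<Sum>(u, v)\<leftarrow>ts'. pure_tensor [inj_K1 u, inj_K1 v])"
    "\<And>a b. op_of k (a \<star> b) = (\<Sum>(u, v)\<leftarrow>ts'. op_of u a \<star> op_of v b)"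
    using assms(1) unfolding K1t_hopf_structure_def by blast
  have neg_left: "- p \<star> q = - (p \<star> q)" for p q
  proof -
    have "\<And>f g :: test_fun. - f * g = - (f * g)" by simp
    then show ?thesis by (simp add: crossed_mult_def single_uminus sum_negf)
  qed
  \<comment> \<open>\<open>ts0\<close> represents the difference of the two tensors.\<close>
  define ts0 where "ts0 = ts' @ map (\<lambda>(u, v). (- u, v)) ts"
  have "(\<Sum>(u, v)\<leftarrow>ts0. pure_tensor [inj_K1 u, inj_K1 v]) = 0"
  proof (rule K1_tensor_faithful)
    fix a b
    have "(\<Sum>(u, v)\<leftarrow>ts. op_of (- u) a \<star> op_of v b) = - (\<Sum>(u, v)\<leftarrow>ts. op_of u a \<star> op_of v b)"
      by (induction ts) (auto simp: uminus_K1.rep_eq neg_left)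
    then show "(\<Sum>(u, v)\<leftarrow>ts0. op_of u a \<star> op_of v b) = 0"
      using ts'(2) [of a b] leibniz [of a b] by (simp add: ts0_def case_prod_unfold o_def)
  qed (intro clinear_pure_tensor2 clinear_inj_K1)+
  moreover have "(\<Sum>(u, v)\<leftarrow>ts. pure_tensor [inj_K1 (- u), inj_K1 v])
      = - (\<Sum>(u, v)\<leftarrow>ts. pure_tensor [inj_K1 u, inj_K1 v])"
    by (induction ts) (auto simp: clinear_simps [OF clinear_pure_tensor2(1) [OF clinear_inj_K1]])
  ultimately show ?thesis
    using ts'(1) by (simp add: ts0_def case_prod_unfold o_def)
qed

lemma coproduct_sigma:
  assumes "K1t_hopf_structure \<Delta> \<epsilon> S"
  shows "\<Delta> (inj_K1 sigma) = pure_tensor [inj_K1 sigma, inj_K1 sigma]"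
  using coproduct_from_leibniz [OF assms, of sigma "[(sigma, sigma)]"]
  by (simp add: sigma.rep_eq sigma_op_mult del: One_nat_def)

lemma coproduct_sigma_inv:
  assumes "K1t_hopf_structure \<Delta> \<epsilon> S"
  shows "\<Delta> (inj_K1 sigma_inv) = pure_tensor [inj_K1 sigma_inv, inj_K1 sigma_inv]"
  using coproduct_from_leibniz [OF assms, of sigma_inv "[(sigma_inv, sigma_inv)]"]
  by (simp add: sigma_inv.rep_eq sigma_inv_op_mult)

lemma coproduct_sigma11:
  assumes "K1t_hopf_structure \<Delta> \<epsilon> S"
  shows "\<Delta> (inj_K1 sigma11) = pure_tensor [inj_K1 sigma11, inj_K1 sigma]
    + pure_tensor [inj_K1 sigma * inj_K1 sigma, inj_K1 sigma11]"
  using coproduct_from_leibniz [OF assms, of sigma11 "[(sigma11, sigma), (sigma * sigma, sigma11)]"]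
  by (simp add: sigma.rep_eq sigma11_eq sigma_jet.rep_eq times_K1.rep_eq sigma_op_2_mult inj_K1_mult
      flip: numeral_2_eq_2)

lemma sigma_jet_0: "sigma_jet 0 = sigma"
  by transfer simp

lemma sigma_inv_mult_sigma: "sigma_inv * sigma = 1" "sigma * sigma_inv = 1"
proof -
  have pos: "vderiv (diffeo_fun \<phi>) x > 0" for \<phi> x
    using diffeo_fun [of \<phi>] by simp
  have "inverse_weight \<phi> (jet_weight 1 \<phi> f) = f" "jet_weight 1 \<phi> (inverse_weight \<phi> f) = f" for \<phi> f
    using less_imp_neq [OF pos, of \<phi>, symmetric]
    by (simp_all add: fun_of_inject [symmetric] fun_eq_iff jet_weight.rep_eq inverse_weight.rep_eq)
  then have "sigma_inv_op (sigma_op 1 a) = a" "sigma_op 1 (sigma_inv_op a) = a" for a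
    by (simp_all add: poly_mapping_eq_iff fun_eq_iff lookup_sigma_op lookup_sigma_inv_op)
  then show "sigma_inv * sigma = 1" "sigma * sigma_inv = 1"
    by (simp_all add: op_of_inject [symmetric] times_K1.rep_eq one_K1.rep_eq sigma.rep_eq
        sigma_inv.rep_eq fun_eq_iff)
qed

lemma inverse_commutes:
  fixes s :: "'a::monoid_mult"
  assumes "t * s = 1" "s * t = 1" "x * s = s * x"
  shows "x * t = t * x"
proof -
  have "x * t = t * (s * x) * t" by (simp add: assms(1) flip: mult.assoc)
  also have "\<dots> = t * x * (s * t)" by (simp only: assms(3) [symmetric] mult.assoc)
  finally show ?thesis by (simp add: assms(2))
qed


section \<open>A cyclic 2-cocycle from a primitive and a skew-primitive element\<close>


lemma cyclic_operator_2:
  assumes "clinear \<Delta>" "clinear S"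
  shows "cyclic_operator \<Delta> S g 2 (pure_tensor [h, k])
      = at_factor 0 \<Delta> (pure_tensor [S h]) \<odot> pure_tensor [k, g]"
    and "clinear (cyclic_operator \<Delta> S g 2)"
proof -
  define \<beta> where "\<beta> h k = at_factor 0 \<Delta> (pure_tensor [S h]) \<odot> pure_tensor [k, g]" for h k
  have "(if length xs = 2
      then case xs of [] \<Rightarrow> pure_tensor []
        | k # ks \<Rightarrow> iterated_coproduct \<Delta> (2 - 1) (S k) \<odot> pure_tensor (ks @ [g])
      else 0) = (case xs of [h, k] \<Rightarrow> \<beta> h k | _ \<Rightarrow> 0)" for xs
    by (auto simp: \<beta>_def split: list.split)
  then have \<tau>: "cyclic_operator \<Delta> S g 2 = tlift (\<lambda>xs. case xs of [h, k] \<Rightarrow> \<beta> h k | _ \<Rightarrow> 0)"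
    by (simp add: cyclic_operator_def)
  have \<beta>: "multilinear (\<lambda>xs. case xs of [h, k] \<Rightarrow> \<beta> h k | _ \<Rightarrow> 0)"
  proof (rule multilinear_bilinear)
    show "clinear (\<beta> h)" for h
      by (intro clinearI) (simp_all add: \<beta>_def
          clinear_simps [OF clinear_slot [OF multilinear_pure_tensor, of "[]" "[g]", simplified]]
          clinear_simps [OF clinear_tmul_right])
    show "clinear (\<lambda>h. \<beta> h k)" for k
      by (intro clinearI) (simp_all add: \<beta>_def
          clinear_simps [OF clinear_slot [OF multilinear_pure_tensor, of "[]" "[]", simplified]]
          clinear_simps [OF assms(2)]
          clinear_simps [OF clinear_tmul_left] clinear_simps [OF clinear_at_factor [OF assms(1)]])
  qed
  show "cyclic_operator \<Delta> S g 2 (pure_tensor [h, k])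
      = at_factor 0 \<Delta> (pure_tensor [S h]) \<odot> pure_tensor [k, g]"
    and "clinear (cyclic_operator \<Delta> S g 2)"
    by (simp_all add: \<tau> tlift_pure [OF \<beta>] tlift_linear [OF \<beta>]) (simp add: \<beta>_def)
qed

text \<open>
  Every term of the coboundary is one of the six tensors obtained by inserting \<open>1\<close> or \<open>t\<close> into
  \<open>l \<otimes> \<alpha>\<close> and \<open>\<alpha> \<otimes> t l\<close>, and each of the six occurs twice with opposite signs. For cyclicity,
  \<open>S l = - l\<close> and \<open>S \<alpha> = - \<alpha> s\<close> give
  \<open>\<tau>(l \<otimes> \<alpha>) = - l \<alpha> \<otimes> t - \<alpha> \<otimes> l t\<close> and \<open>\<tau>(\<alpha> \<otimes> t l) = - \<alpha> l \<otimes> t - l \<otimes> \<alpha>\<close>;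
  the terms ending in \<open>\<otimes> t\<close> cancel because \<open>l\<close> and \<open>\<alpha>\<close> commute.
\<close>

lemma skew_primitive_cocycle:
  fixes \<Delta> :: "'h::complex_algebra_1 \<Rightarrow> 'h tensor" and \<epsilon> :: "'h \<Rightarrow> complex" and S :: "'h \<Rightarrow> 'h"
  assumes hopf: "hopf_algebra \<Delta> \<epsilon> S"
    and group_like: "t * s = 1" "s * t = 1" "\<Delta> s = pure_tensor [s, s]"  "\<Delta> t = pure_tensor [t, t]"
    and primitive: "\<Delta> l = pure_tensor [l, 1] + pure_tensor [1, l]" "S l = - l"
    and skew_primitive: "\<Delta> \<alpha> = pure_tensor [\<alpha>, t] + pure_tensor [1, \<alpha>]" "\<epsilon> \<alpha> = 0"
    and commute: "l * s = s * l" "l * \<alpha> = \<alpha> * l"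
  shows "cyclic_cocycle \<Delta> S t 2 (pure_tensor [l, \<alpha>] - pure_tensor [\<alpha>, t * l])"
proof -
  have \<Delta>: "clinear \<Delta>" "\<And>g h. \<Delta> (g * h) = \<Delta> g \<odot> \<Delta> h" "\<Delta> 1 = pure_tensor [1, 1]"
    and S: "clinear S"
    and antipode: "\<And>h. tlift (\<lambda>xs. case xs of [x, y] \<Rightarrow> S x * y | _ \<Rightarrow> 0) (\<Delta> h) = \<epsilon> h *\<^sub>C 1"
    and \<epsilon>1: "\<epsilon> 1 = 1"
    using hopf unfolding hopf_algebra_def by auto
  note S_simps = clinear_simps [OF S]
  have lt: "l * t = t * l"
    by (rule inverse_commutes [OF group_like(1,2) commute(1)])
  note mult_lin = clinear_simps [OF clinear_tmul_left] clinear_simps [OF clinear_tmul_right]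
  note lin = clinear_simps [OF clinear_tcat_left] clinear_simps [OF clinear_tcat_right]
    clinear_simps [OF clinear_at_factor [OF \<Delta>(1)]]
  have mult_S: "tlift (\<lambda>xs. case xs of [x, y] \<Rightarrow> S x * y | _ \<Rightarrow> 0) (pure_tensor [x, y]) = S x * y"
    "clinear (tlift (\<lambda>xs. case xs of [x, y] \<Rightarrow> S x * y | _ \<Rightarrow> 0))" for x y
  proof -
    have "multilinear (\<lambda>xs. case xs of [x, y] \<Rightarrow> S x * y | _ \<Rightarrow> 0)"
      by (rule multilinear_bilinear; rule clinearI)
        (simp_all add: S_simps semiring_class.distrib_left semiring_class.distrib_right
          mult_scaleC_left mult_scaleC_right)
    then show "tlift (\<lambda>xs. case xs of [x, y] \<Rightarrow> S x * y | _ \<Rightarrow> 0) (pure_tensor [x, y]) = S x * y"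
      "clinear (tlift (\<lambda>xs. case xs of [x, y] \<Rightarrow> S x * y | _ \<Rightarrow> 0))"
      by (simp_all add: tlift_pure tlift_linear)
  qed
  have S1: "S 1 = 1"
    using antipode [of 1] by (simp add: \<Delta> mult_S \<epsilon>1 scaleC_one)
  have S\<alpha>: "S \<alpha> = - (\<alpha> * s)"
  proof -
    have "S \<alpha> * t + \<alpha> = 0"
      using antipode [of \<alpha>]
      by (simp add: skew_primitive clinear_simps [OF mult_S(2)] mult_S(1) S1)
    then have "(S \<alpha> * t + \<alpha>) * s = 0" by simp
    then show ?thesis
      by (simp add: semiring_class.distrib_right mult.assoc group_like eq_neg_iff_add_eq_0)
  qed
  have \<Delta>S: "\<Delta> (S l) = - pure_tensor [l, 1] - pure_tensor [1, l]"
    "\<Delta> (S \<alpha>) = - pure_tensor [\<alpha> * s, 1] - pure_tensor [s, \<alpha> * s]"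
    by (simp_all add: primitive S\<alpha> clinear_simps [OF \<Delta>(1)] \<Delta>(2) skew_primitive group_like mult_lin
        tmul_pure)
  have \<Delta>tl: "\<Delta> (t * l) = pure_tensor [t * l, t] + pure_tensor [t, t * l]"
    by (simp add: \<Delta>(2) group_like primitive mult_lin tmul_pure)
  have at0: "at_factor 0 \<Delta> (pure_tensor [h]) = pure_tensor [] \<otimes> \<Delta> h \<otimes> pure_tensor []" for h
    by (simp add: at_factor_pure [OF \<Delta>(1)])
  let ?GV = "pure_tensor [l, \<alpha>] - pure_tensor [\<alpha>, t * l]"
  have "?GV \<in> tpow 2"
    unfolding tpow_def by (intro cv.span_diff cv.span_base) auto
  moreover have "hochschild_coboundary \<Delta> t 2 ?GV = 0"
  proof -
    have "hochschild_coboundary \<Delta> t 2 ?GV = coface \<Delta> t 2 0 ?GV - coface \<Delta> t 2 1 ?GV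
        + coface \<Delta> t 2 2 ?GV - coface \<Delta> t 2 3 ?GV"
      by (simp add: hochschild_coboundary_def numeral_eq_Suc scaleC_one)
    also have "\<dots> = 0"
      by (simp add: coface_def lin at_factor_pure [OF \<Delta>(1)] primitive skew_primitive \<Delta>tl tcat_pure
          numeral_eq_Suc)
    finally show ?thesis .
  qed
  moreover have "cyclic_operator \<Delta> S t 2 ?GV = (- 1) ^ 2 *\<^sub>C ?GV"
  proof -
    have "\<alpha> * s * (t * l) = \<alpha> * l" "s * (t * l) = l" "\<alpha> * s * t = \<alpha>"
      using group_like by (simp_all add: mult.assoc flip: mult.assoc [of s t])
    then show ?thesis
      by (simp add: clinear_simps [OF cyclic_operator_2(2) [OF \<Delta>(1) S]]
          cyclic_operator_2(1) [OF \<Delta>(1) S] at0 \<Delta>S lin tcat_pure mult_lin tmul_pure scaleC_one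
          commute lt)
  qed
  ultimately show ?thesis by (simp add: cyclic_cocycle_def)
qed

theorem proposition6p5:
  fixes \<Delta> :: "K1t \<Rightarrow> K1t tensor" and \<epsilon> :: "K1t \<Rightarrow> complex" and S :: "K1t \<Rightarrow> K1t"
  assumes "K1t_hopf_structure \<Delta> \<epsilon> S"
  shows "cyclic_cocycle \<Delta> S (inj_K1 sigma_inv) 2 GV"
proof -
  have hopf: "hopf_algebra \<Delta> \<epsilon> S"
    and log: "\<Delta> log_sigma = pure_tensor [log_sigma, 1] + pure_tensor [1, log_sigma]" "S log_sigma = - log_sigma"
    using assms unfolding K1t_hopf_structure_def by auto
  have \<Delta>: "\<And>g h. \<Delta> (g * h) = \<Delta> g \<odot> \<Delta> h" and \<epsilon>: "\<And>g h. \<epsilon> (g * h) = \<epsilon> g * \<epsilon> h" "clinear \<epsilon>"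
    using hopf unfolding hopf_algebra_def by auto
  define s t d where "s = inj_K1 sigma" and "t = inj_K1 sigma_inv" and "d = inj_K1 sigma11"
  have inv: "t * s = 1" "s * t = 1"
    by (simp_all add: s_def t_def sigma_inv_mult_sigma inj_K1_one flip: inj_K1_mult)
  have log_commutes: "log_sigma * s = s * log_sigma" "log_sigma * d = d * log_sigma"
    using commutator_log_sigma [of 0] commutator_log_sigma [of 1]
    by (simp_all add: s_def d_def sigma_jet_0 sigma11_eq)
  have lt: "log_sigma * t = t * log_sigma"
    by (rule inverse_commutes [OF inv log_commutes(1)])
  define \<alpha> where "\<alpha> = t * t * d"
  have GV: "GV = pure_tensor [log_sigma, \<alpha>] - pure_tensor [\<alpha>, t * log_sigma]"
    by (simp add: GV_def \<alpha>_def t_def d_def power2_eq_square inj_K1_mult)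
  \<comment> \<open>The factor \<open>\<sigma>\<^sup>-\<^sup>2 \<otimes> \<sigma>\<^sup>-\<^sup>2\<close> turns \<open>\<sigma>\<close> and \<open>\<sigma>\<^sup>2\<close> in \<open>\<Delta> \<sigma>\<^sup>1\<^sub>1\<^sub>,\<^sub>1\<close> into \<open>\<sigma>\<^sup>-\<^sup>1\<close> and \<open>1\<close>.\<close>
  have cancel: "t * (s * x) = x" for x
    by (simp add: inv flip: mult.assoc)
  have \<Delta>\<alpha>: "\<Delta> \<alpha> = pure_tensor [\<alpha>, t] + pure_tensor [1, \<alpha>]"
    by (simp add: \<alpha>_def t_def s_def d_def \<Delta> coproduct_sigma_inv [OF assms] coproduct_sigma11 [OF assms]
      tmul_pure clinear_simps [OF clinear_tmul_right])
      (simp add: t_def [symmetric] s_def [symmetric] d_def [symmetric] mult.assoc cancel inv)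
  \<comment> \<open>\<open>\<epsilon>\<close> kills the commutator \<open>[X\<^sub>1, \<sigma>]\<close>.\<close>
  have \<epsilon>\<alpha>: "\<epsilon> \<alpha> = 0"
    by (simp add: \<alpha>_def d_def \<epsilon>(1) sigma11_def inj_K1_mult clinear_simps [OF clinear_inj_K1]
      clinear_simps [OF \<epsilon>(2)])
  show ?thesis
    unfolding GV t_def [symmetric]
  proof (rule skew_primitive_cocycle [OF hopf inv _ _ log \<Delta>\<alpha> \<epsilon>\<alpha>])
    show "\<Delta> s = pure_tensor [s, s]" "\<Delta> t = pure_tensor [t, t]"
      by (simp_all add: s_def t_def coproduct_sigma [OF assms] coproduct_sigma_inv [OF assms])
    show "log_sigma * s = s * log_sigma" by (rule log_commutes)
    show "log_sigma * \<alpha> = \<alpha> * log_sigma"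
      unfolding \<alpha>_def by (metis lt log_commutes(2) mult.assoc)
  qed
qed

end
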